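(* (i) Assume that for any diagram $B\to A\leftarrow C$ in $\mathbf D$ a pullback in $\mathbf C$ can be found in finite time, for any object $U$ of $\mathbf C$ the set $\Sigma(U)$ can be determined in finite time, and for any cover $f$ the value $\deg f$ can be computed in finite time. Then Algorithm R terminates on every input cover. (ii) Assume moreover (G5): for every object $U$ of $\mathbf C$, every arrow in $\Sigma(U)$ is monic. Then for every input cover $f$, the output of Algorithm R is a Galois closure of $f$.
   Context: Let $\mathbf C$ be a category and $\mathbf D$ a full subcategory of $\mathbf C$. For arrows $f,g$ of $\mathbf C$ with ${\rm cod}\,f={\rm cod}\,g$, ${\rm Hom}(g,f)$ denotes the collection of all arrows $h$ of $\mathbf C$ with $g=f\circ h$. Standing assumptions: (G1) every diagram $B\to A\leftarrow C$ in $\mathbf D$ has a pullback in $\mathbf C$. (G2) (I) pushouts exist in $\mathbf D$; (II) every arrow of $\mathbf D$ is epic; (III) every monic arrow of $\mathbf D$ is an isomorphism whose inverse is an arrow of $\mathbf D$. (G3) for every object $U$ of $\mathbf C$ there is a set $\Sigma(U)$ of arrows $i$ of $\mathbf C$ with ${\rm dom}\,i$ in $\mathbf D$ and ${\rm cod}\,i=U$ such that for every arrow $u$ of $\mathbf C$ with ${\rm dom}\,u$ in $\mathbf D$ and ${\rm cod}\,u=U$ there is exactly one $i\in\Sigma(U)$ with ${\rm Hom}(u,i)\neq\emptyset$. (G4) there is a function $\deg$ from the collection of arrows of $\mathbf C$ whose codomain lies in $\mathbf D$ to the positive integers such that (I) $\deg(g\circ f)=\deg g\cdot\deg f$ whenever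 $f,g,g\circ f$ all lie in this collection; (II) $\deg f=\sum_{i\in\Sigma({\rm dom}\,f)}\deg(f\circ i)$ for every such $f$; (III) if $B\xrightarrow{f}A\xleftarrow{g}C$ is a diagram in $\mathbf D$ with pullback $B\xleftarrow{p}U\xrightarrow{q}C$, then $\deg f=\deg q$ and $\deg g=\deg p$. A cover is an arrow of $\mathbf D$. For a cover $f$, ${\rm Aut}(f)$ is the set of isomorphisms in ${\rm Hom}(f,f)$; $f$ is Galois if $|{\rm Aut}(f)|=\deg f$. Write $f\sqsubseteq g$ if ${\rm cod}\,f={\rm cod}\,g$ and ${\rm Hom}(g,f)\neq\emptyset$. A Galois closure of a cover $f$ is a cover $g$ which is Galois with $f\sqsubseteq g$ and such that $g\sqsubseteq h$ for every Galois cover $h$ with $f\sqsubseteq h\sqsubseteq g$. Algorithm R (recursive; $\mathds R(h)$ denotes the output of Algorithm R on input cover $h$). Input: a cover $f:B\to A$. (1) If $\deg f\le2$, output $f$; else go to (2). (2) Choose a pullback $B\xleftarrow{p}U\xrightarrow{q}B$ of $B\xrightarrow{f}A\xleftarrow{f}B$ and go to (3). (3) Set $S=\{\mathds R(p\circ i)\mid i\in\Sigma(U)\}$ (a set of covers with codomain $B$) and go to (4). (4) While $|S|>1$: (i) pick two distinct covers $g:C\to B$ and $h:D\to B$ in $S$; (ii) choose a pullback $C\xleftarrow{r}V\xrightarrow{s}D$ of $C\xrightarrow{g}B\xleftarrow{h}D$; (iii) choose $i\in\Sigma(V)$ and replace $S$ by $(S\setminus\{g,h\})\cup\{g\circ r\circ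 i\}$. (5) Output $f\circ g$, where $g$ is the sole cover in $S$. *)

theory Defs
  imports Main "HOL-Library.Extended_Nat"
begin

section \<open>Categories\<close>

record ('o, 'a) cat =
  Obj :: "'o set"
  Arr :: "'a set"
  Dom :: "'a \<Rightarrow> 'o"
  Cod :: "'a \<Rightarrow> 'o"
  Id :: "'o \<Rightarrow> 'a"
  Cmp :: "'a \<Rightarrow> 'a \<Rightarrow> 'a" (infixr "\<odot>\<index>" 70)

locale category =
  fixes C :: "('o, 'a, 'm) cat_scheme" (structure)
  assumes Dom_Obj: "f \<in> Arr C \<Longrightarrow> Dom C f \<in> Obj C"
    and Cod_Obj: "f \<in> Arr C \<Longrightarrow> Cod C f \<in> Obj C"
    and Id_Arr: "A \<in> Obj C \<Longrightarrow> Id C A \<in> Arr C"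
    and Dom_Id: "A \<in> Obj C \<Longrightarrow> Dom C (Id C A) = A"
    and Cod_Id: "A \<in> Obj C \<Longrightarrow> Cod C (Id C A) = A"
    and Cmp_Arr: "\<lbrakk>f \<in> Arr C; g \<in> Arr C; Cod C f = Dom C g\<rbrakk> \<Longrightarrow> g \<odot> f \<in> Arr C"
    and Dom_Cmp: "\<lbrakk>f \<in> Arr C; g \<in> Arr C; Cod C f = Dom C g\<rbrakk> \<Longrightarrow> Dom C (g \<odot> f) = Dom C f"
    and Cod_Cmp: "\<lbrakk>f \<in> Arr C; g \<in> Arr C; Cod C f = Dom C g\<rbrakk> \<Longrightarrow> Cod C (g \<odot> f) = Cod C g"
    and Cmp_Id: "f \<in> Arr C \<Longrightarrow> f \<odot> Id C (Dom C f) = f"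
    and Id_Cmp: "f \<in> Arr C \<Longrightarrow> Id C (Cod C f) \<odot> f = f"
    and Cmp_assoc: "\<lbrakk>f \<in> Arr C; g \<in> Arr C; h \<in> Arr C; Cod C f = Dom C g; Cod C g = Dom C h\<rbrakk>
      \<Longrightarrow> h \<odot> (g \<odot> f) = (h \<odot> g) \<odot> f"

definition full_sub :: "('o, 'a) cat \<Rightarrow> 'o set \<Rightarrow> ('o, 'a) cat" where
  "full_sub C D = C\<lparr>Obj := D, Arr := {f \<in> Arr C. Dom C f \<in> D \<and> Cod C f \<in> D}\<rparr>"

definition monic :: "('o, 'a) cat \<Rightarrow> 'a \<Rightarrow> bool" where
  "monic C m \<longleftrightarrow> m \<in> Arr C \<and>
    (\<forall>x\<in>Arr C. \<forall>y\<in>Arr C. Dom C x = Dom C y \<and> Cod C x = Dom C m \<and> Cod C y = Dom C m \<and>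
      m \<odot>\<^bsub>C\<^esub> x = m \<odot>\<^bsub>C\<^esub> y \<longrightarrow> x = y)"

definition epic :: "('o, 'a) cat \<Rightarrow> 'a \<Rightarrow> bool" where
  "epic C e \<longleftrightarrow> e \<in> Arr C \<and>
    (\<forall>x\<in>Arr C. \<forall>y\<in>Arr C. Cod C x = Cod C y \<and> Dom C x = Cod C e \<and> Dom C y = Cod C e \<and>
      x \<odot>\<^bsub>C\<^esub> e = y \<odot>\<^bsub>C\<^esub> e \<longrightarrow> x = y)"

definition inverse_arrows :: "('o, 'a) cat \<Rightarrow> 'a \<Rightarrow> 'a \<Rightarrow> bool" where
  "inverse_arrows C f g \<longleftrightarrow> f \<in> Arr C \<and> g \<in> Arr C \<and> Dom C g = Cod C f \<and> Cod C g = Dom C f \<and>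
    g \<odot>\<^bsub>C\<^esub> f = Id C (Dom C f) \<and> f \<odot>\<^bsub>C\<^esub> g = Id C (Cod C f)"

definition iso :: "('o, 'a) cat \<Rightarrow> 'a \<Rightarrow> bool" where
  "iso C f \<longleftrightarrow> (\<exists>g. inverse_arrows C f g)"

text \<open>\<open>is_pullback C f g p q\<close>: the span \<open>p, q\<close> is a pullback of the cospan \<open>f, g\<close>,
  with \<open>f \<odot> p = g \<odot> q\<close>; dually for \<open>is_pushout\<close>.\<close>

definition is_pullback :: "('o, 'a) cat \<Rightarrow> 'a \<Rightarrow> 'a \<Rightarrow> 'a \<Rightarrow> 'a \<Rightarrow> bool" where
  "is_pullback C f g p q \<longleftrightarrow>
    f \<in> Arr C \<and> g \<in> Arr C \<and> p \<in> Arr C \<and> q \<in> Arr C \<and>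
    Cod C f = Cod C g \<and> Dom C p = Dom C q \<and> Cod C p = Dom C f \<and> Cod C q = Dom C g \<and>
    f \<odot>\<^bsub>C\<^esub> p = g \<odot>\<^bsub>C\<^esub> q \<and>
    (\<forall>x\<in>Arr C. \<forall>y\<in>Arr C.
      Dom C x = Dom C y \<and> Cod C x = Dom C f \<and> Cod C y = Dom C g \<and> f \<odot>\<^bsub>C\<^esub> x = g \<odot>\<^bsub>C\<^esub> y \<longrightarrow>
      (\<exists>!u. u \<in> Arr C \<and> Dom C u = Dom C x \<and> Cod C u = Dom C p \<and>
        p \<odot>\<^bsub>C\<^esub> u = x \<and> q \<odot>\<^bsub>C\<^esub> u = y))"

definition is_pushout :: "('o, 'a) cat \<Rightarrow> 'a \<Rightarrow> 'a \<Rightarrow> 'a \<Rightarrow> 'a \<Rightarrow> bool" where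
  "is_pushout C f g p q \<longleftrightarrow>
    f \<in> Arr C \<and> g \<in> Arr C \<and> p \<in> Arr C \<and> q \<in> Arr C \<and>
    Dom C f = Dom C g \<and> Cod C p = Cod C q \<and> Dom C p = Cod C f \<and> Dom C q = Cod C g \<and>
    p \<odot>\<^bsub>C\<^esub> f = q \<odot>\<^bsub>C\<^esub> g \<and>
    (\<forall>x\<in>Arr C. \<forall>y\<in>Arr C.
      Cod C x = Cod C y \<and> Dom C x = Cod C f \<and> Dom C y = Cod C g \<and> x \<odot>\<^bsub>C\<^esub> f = y \<odot>\<^bsub>C\<^esub> g \<longrightarrow>
      (\<exists>!u. u \<in> Arr C \<and> Cod C u = Cod C x \<and> Dom C u = Cod C p \<and>
        u \<odot>\<^bsub>C\<^esub> p = x \<and> u \<odot>\<^bsub>C\<^esub> q = y))"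

text \<open>\<open>Hom_over C g f\<close> is the collection Hom\<open>(g, f)\<close> of all \<open>h\<close> with \<open>g = f \<odot> h\<close>.\<close>

definition Hom_over :: "('o, 'a) cat \<Rightarrow> 'a \<Rightarrow> 'a \<Rightarrow> 'a set" where
  "Hom_over C g f = {h \<in> Arr C. Cod C h = Dom C f \<and> g = f \<odot>\<^bsub>C\<^esub> h}"

section \<open>Covers and Galois closures\<close>

abbreviation cover :: "('o, 'a) cat \<Rightarrow> 'o set \<Rightarrow> 'a \<Rightarrow> bool" where
  "cover C D f \<equiv> f \<in> Arr (full_sub C D)"

text \<open>The full subcategory is given by its set of objects \<open>D\<close>. Epic and monic arrows of the
  subcategory are meant in the sense of the subcategory, as are the pushouts, whereas pullbacks
  are taken in \<open>C\<close>. Since \<open>deg\<close> is positive, \<open>G4_sum\<close> forces \<open>Sig (Dom C f)\<close> to be finite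
  (an infinite sum would be \<open>0\<close>) and nonempty.\<close>

locale galois_setting = category C
  for C :: "('o, 'a) cat" (structure) +
  fixes D :: "'o set" and Sig :: "'o \<Rightarrow> 'a set" and deg :: "'a \<Rightarrow> nat"
  assumes full_subcategory: "D \<subseteq> Obj C"
    and G1: "\<lbrakk>cover C D f; cover C D g; Cod C f = Cod C g\<rbrakk> \<Longrightarrow> \<exists>p q. is_pullback C f g p q"
    and G2_pushout: "\<lbrakk>cover C D f; cover C D g; Dom C f = Dom C g\<rbrakk>
      \<Longrightarrow> \<exists>p q. is_pushout (full_sub C D) f g p q"
    and G2_epic: "cover C D f \<Longrightarrow> epic (full_sub C D) f"
    and G2_monic: "monic (full_sub C D) f \<Longrightarrow> \<exists>g. inverse_arrows C f g \<and> cover C D g"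
    and G3_Sig: "\<lbrakk>U \<in> Obj C; i \<in> Sig U\<rbrakk> \<Longrightarrow> i \<in> Arr C \<and> Dom C i \<in> D \<and> Cod C i = U"
    and G3_unique: "\<lbrakk>U \<in> Obj C; u \<in> Arr C; Dom C u \<in> D; Cod C u = U\<rbrakk>
      \<Longrightarrow> \<exists>!i. i \<in> Sig U \<and> Hom_over C u i \<noteq> {}"
    and G4_pos: "\<lbrakk>f \<in> Arr C; Cod C f \<in> D\<rbrakk> \<Longrightarrow> 0 < deg f"
    and G4_mult: "\<lbrakk>f \<in> Arr C; g \<in> Arr C; Cod C f = Dom C g; Cod C f \<in> D; Cod C g \<in> D\<rbrakk>
      \<Longrightarrow> deg (g \<odot> f) = deg g * deg f"
    and G4_sum: "\<lbrakk>f \<in> Arr C; Cod C f \<in> D\<rbrakk> \<Longrightarrow> deg f = (\<Sum>i\<in>Sig (Dom C f). deg (f \<odot> i))"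
    and G4_pullback: "\<lbrakk>cover C D f; cover C D g; is_pullback C f g p q\<rbrakk>
      \<Longrightarrow> deg f = deg q \<and> deg g = deg p"

definition Aut :: "('o, 'a) cat \<Rightarrow> 'a \<Rightarrow> 'a set" where
  "Aut C f = {h \<in> Hom_over C f f. iso C h}"

definition galois :: "('o, 'a) cat \<Rightarrow> 'o set \<Rightarrow> ('a \<Rightarrow> nat) \<Rightarrow> 'a \<Rightarrow> bool" where
  "galois C D deg f \<longleftrightarrow> cover C D f \<and> finite (Aut C f) \<and> card (Aut C f) = deg f"

definition below :: "('o, 'a) cat \<Rightarrow> 'a \<Rightarrow> 'a \<Rightarrow> bool" (infix "\<sqsubseteq>\<index>" 50) where
  "f \<sqsubseteq>\<^bsub>C\<^esub> g \<longleftrightarrow> Cod C f = Cod C g \<and> Hom_over C g f \<noteq> {}"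

definition galois_closure :: "('o, 'a) cat \<Rightarrow> 'o set \<Rightarrow> ('a \<Rightarrow> nat) \<Rightarrow> 'a \<Rightarrow> 'a \<Rightarrow> bool" where
  "galois_closure C D deg f g \<longleftrightarrow> galois C D deg g \<and> f \<sqsubseteq>\<^bsub>C\<^esub> g \<and>
    (\<forall>h. galois C D deg h \<and> f \<sqsubseteq>\<^bsub>C\<^esub> h \<and> h \<sqsubseteq>\<^bsub>C\<^esub> g \<longrightarrow> g \<sqsubseteq>\<^bsub>C\<^esub> h)"

section \<open>Algorithm R\<close>

text \<open>The algorithm is a nondeterministic abstract machine with an explicit recursion stack.
  A state is \<open>(t, c, st)\<close>, where \<open>c\<close> is the current control point, \<open>st\<close> the stack of suspended
  calls, and \<open>t\<close> the time still needed for the primitive operation (evaluating \<open>deg\<close>, finding a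
  pullback, determining \<open>Sig U\<close>) that \<open>c\<close> is waiting for. A primitive operation that takes
  infinite time blocks the machine in a loop, as \<open>eSuc \<infinity> = \<infinity>\<close> in rule \<open>tick\<close>.

  Control points: \<open>Call f\<close> is step (1) on input \<open>f\<close>; \<open>Pullback f\<close> is step (2);
  \<open>Components f p\<close> and \<open>Collect f p I S\<close> are step (3), where \<open>I\<close> holds the arrows
  \<open>i\<close> for which the recursive call on \<open>p \<odot> i\<close> has not been made and \<open>S\<close> the outputs obtained so
  far; \<open>Loop f S\<close>, \<open>Loop_Pullback f S g h\<close> and \<open>Loop_Component f S g h r\<close> are step (4) with its
  parts (i), (ii), (iii), where \<open>|S| > 1\<close> is the existence of the distinct elements \<open>g, h\<close>
  to be picked; \<open>Return g\<close> delivers the output \<open>g\<close>. A stack entry \<open>(f, p, I, S)\<close> is a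
  computation on input \<open>f\<close> waiting in step (3) for the output of a recursive call.\<close>

datatype 'a control =
    Call 'a
  | Pullback 'a
  | Components 'a 'a
  | Collect 'a 'a "'a set" "'a set"
  | Loop 'a "'a set"
  | Loop_Pullback 'a "'a set" 'a 'a
  | Loop_Component 'a "'a set" 'a 'a 'a
  | Return 'a

type_synonym 'a state = "enat \<times> 'a control \<times> ('a \<times> 'a \<times> 'a set \<times> 'a set) list"

inductive R_step ::
  "('o, 'a) cat \<Rightarrow> ('o \<Rightarrow> 'a set) \<Rightarrow> ('a \<Rightarrow> nat) \<Rightarrow>
   ('a \<Rightarrow> 'a \<Rightarrow> enat) \<Rightarrow> ('o \<Rightarrow> enat) \<Rightarrow> ('a \<Rightarrow> enat) \<Rightarrow> 'a state \<Rightarrow> 'a state \<Rightarrow> bool"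
  for C (structure) and Sig deg pb_time Sig_time deg_time
where
  tick: "R_step C Sig deg pb_time Sig_time deg_time (eSuc t, c, st) (t, c, st)"
| small: "deg f \<le> 2 \<Longrightarrow>
    R_step C Sig deg pb_time Sig_time deg_time
      (0, Call f, st) (0, Return f, st)"
| large: "\<not> deg f \<le> 2 \<Longrightarrow>
    R_step C Sig deg pb_time Sig_time deg_time
      (0, Call f, st) (pb_time f f, Pullback f, st)"
| pullback: "is_pullback C f f p q \<Longrightarrow>
    R_step C Sig deg pb_time Sig_time deg_time
      (0, Pullback f, st) (Sig_time (Dom C p), Components f p, st)"
| components:
   "R_step C Sig deg pb_time Sig_time deg_time
      (0, Components f p, st) (0, Collect f p (Sig (Dom C p)) {}, st)"
| rec_call: "i \<in> I \<Longrightarrow>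
    R_step C Sig deg pb_time Sig_time deg_time
      (0, Collect f p I S, st) (deg_time (p \<odot> i), Call (p \<odot> i), (f, p, I - {i}, S) # st)"
| rec_return:
   "R_step C Sig deg pb_time Sig_time deg_time
      (0, Return g, (f, p, I, S) # st) (0, Collect f p I (insert g S), st)"
| collected:
   "R_step C Sig deg pb_time Sig_time deg_time
      (0, Collect f p {} S, st) (0, Loop f S, st)"
| loop_pick: "\<lbrakk>g \<in> S; h \<in> S; g \<noteq> h\<rbrakk> \<Longrightarrow>
    R_step C Sig deg pb_time Sig_time deg_time
      (0, Loop f S, st) (pb_time g h, Loop_Pullback f S g h, st)"
| loop_pullback: "is_pullback C g h r s \<Longrightarrow>
    R_step C Sig deg pb_time Sig_time deg_time
      (0, Loop_Pullback f S g h, st) (Sig_time (Dom C r), Loop_Component f S g h r, st)"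
| loop_component: "i \<in> Sig (Dom C r) \<Longrightarrow>
    R_step C Sig deg pb_time Sig_time deg_time
      (0, Loop_Component f S g h r, st) (0, Loop f ((S - {g, h}) \<union> {g \<odot> r \<odot> i}), st)"
| loop_exit:
   "R_step C Sig deg pb_time Sig_time deg_time
      (0, Loop f {g}, st) (0, Return (f \<odot> g), st)"

definition R_start :: "('a \<Rightarrow> enat) \<Rightarrow> 'a \<Rightarrow> 'a state" where
  "R_start deg_time f = (deg_time f, Call f, [])"

definition R_outputs ::
  "('o, 'a) cat \<Rightarrow> ('o \<Rightarrow> 'a set) \<Rightarrow> ('a \<Rightarrow> nat) \<Rightarrow>
   ('a \<Rightarrow> 'a \<Rightarrow> enat) \<Rightarrow> ('o \<Rightarrow> enat) \<Rightarrow> ('a \<Rightarrow> enat) \<Rightarrow> 'a \<Rightarrow> 'a \<Rightarrow> bool" where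
  "R_outputs C Sig deg pb_time Sig_time deg_time f g \<longleftrightarrow>
    (R_step C Sig deg pb_time Sig_time deg_time)\<^sup>*\<^sup>* (R_start deg_time f) (0, Return g, [])"

text \<open>Termination on input \<open>f\<close>, for every way of making the choices: there is no infinite run,
  and a run that cannot be continued has delivered an output (no choice required by the
  algorithm is ever impossible).\<close>

definition R_terminates ::
  "('o, 'a) cat \<Rightarrow> ('o \<Rightarrow> 'a set) \<Rightarrow> ('a \<Rightarrow> nat) \<Rightarrow>
   ('a \<Rightarrow> 'a \<Rightarrow> enat) \<Rightarrow> ('o \<Rightarrow> enat) \<Rightarrow> ('a \<Rightarrow> enat) \<Rightarrow> 'a \<Rightarrow> bool" where
  "R_terminates C Sig deg pb_time Sig_time deg_time f \<longleftrightarrow>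
    (let step = R_step C Sig deg pb_time Sig_time deg_time in
      \<not> (\<exists>x. x 0 = R_start deg_time f \<and> (\<forall>n::nat. step (x n) (x (Suc n)))) \<and>
      (\<forall>x. step\<^sup>*\<^sup>* (R_start deg_time f) x \<and> \<not> (\<exists>y. step x y) \<longrightarrow> (\<exists>g. x = (0, Return g, []))))"

end

theory Submission
  imports Defs
begin

text \<open>Say that \<open>g\<close> splits \<open>f\<close> if \<open>g \<odot> x = f \<odot> y\<close> forces \<open>y\<close> to factor through \<open>x\<close> over the
  codomain. Automorphisms of \<open>f\<close> correspond to the components of degree 1 of the pullback of
  \<open>f\<close> along itself, so \<open>f\<close> is Galois iff \<open>f\<close> splits itself. The output \<open>g\<close> on input \<open>f\<close> is a
  self-splitting cover above \<open>f\<close> that lies below every cover splitting \<open>f\<close>. This passes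
  through the recursion: a cover \<open>f \<odot> e\<close> splits \<open>f\<close> only if \<open>e\<close> splits every \<open>p \<odot> i\<close>, and
  components of pullbacks of self-splitting covers are their joins. The recursion is
  well-founded because the diagonal contributes a component of degree 1, so all components
  have smaller degree than \<open>f\<close> as soon as \<open>deg f > 2\<close>.\<close>

section \<open>Covers and components\<close>

context galois_setting
begin

section \<open>Arrows and covers with named ends, and their degrees\<close>

definition arrow :: "'a \<Rightarrow> 'o \<Rightarrow> 'o \<Rightarrow> bool" where
  "arrow f X Y \<longleftrightarrow> f \<in> Arr C \<and> Dom C f = X \<and> Cod C f = Y"

text \<open>Both ends are parameters, so that composability becomes matching of variables and side
  conditions are discharged by \<open>OF\<close>.\<close>

definition cov :: "'a \<Rightarrow> 'o \<Rightarrow> 'o \<Rightarrow> bool" where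
  "cov f X Y \<longleftrightarrow> arrow f X Y \<and> X \<in> D \<and> Y \<in> D"

lemma cover_iff_cov: "cover C D f \<longleftrightarrow> cov f (Dom C f) (Cod C f)"
  by (auto simp: full_sub_def cov_def arrow_def)

lemma cover_obtains_cov:
  assumes "cover C D f"
  obtains X Y where "cov f X Y"
  using assms cover_iff_cov by blast

lemma cov_cover: "cov f X Y \<Longrightarrow> cover C D f"
  by (auto simp: full_sub_def cov_def arrow_def)

lemma cov_Dom: "cov f X Y \<Longrightarrow> Dom C f = X"
  and cov_Cod: "cov f X Y \<Longrightarrow> Cod C f = Y"
  and cov_arrow: "cov f X Y \<Longrightarrow> arrow f X Y"
  and cov_Dom_in: "cov f X Y \<Longrightarrow> X \<in> D"
  and cov_Cod_in: "cov f X Y \<Longrightarrow> Y \<in> D"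
  by (auto simp: cov_def arrow_def)

lemma arrow_cmp: "arrow f X Y \<Longrightarrow> arrow g Y Z \<Longrightarrow> arrow (g \<odot> f) X Z"
  using Cmp_Arr Dom_Cmp Cod_Cmp by (auto simp: arrow_def)

lemma cov_cmp: "cov f X Y \<Longrightarrow> cov g Y Z \<Longrightarrow> cov (g \<odot> f) X Z"
  using arrow_cmp by (auto simp: cov_def)

lemma arrow_assoc:
  "arrow f W X \<Longrightarrow> arrow g X Y \<Longrightarrow> arrow h Y Z \<Longrightarrow> (h \<odot> g) \<odot> f = h \<odot> (g \<odot> f)"
  by (rule Cmp_assoc[symmetric]) (simp_all add: arrow_def)

lemma cov_assoc:
  "cov f W X \<Longrightarrow> cov g X Y \<Longrightarrow> cov h Y Z \<Longrightarrow> (h \<odot> g) \<odot> f = h \<odot> (g \<odot> f)"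
  by (rule arrow_assoc[OF cov_arrow cov_arrow cov_arrow])

lemma cov_Id: "X \<in> D \<Longrightarrow> cov (Id C X) X X"
  using full_subcategory Id_Arr Dom_Id Cod_Id by (auto simp: cov_def arrow_def)

lemma cov_Cmp_Id: "cov f X Y \<Longrightarrow> f \<odot> Id C X = f"
  and cov_Id_Cmp: "cov f X Y \<Longrightarrow> Id C Y \<odot> f = f"
  using Cmp_Id Id_Cmp by (auto simp: cov_def arrow_def)

lemma cov_epic:
  assumes "cov e X Y" "cov a Y Z" "cov b Y Z" "a \<odot> e = b \<odot> e"
  shows "a = b"
proof -
  have "epic (full_sub C D) e"
    using G2_epic cov_cover assms(1) by blast
  moreover have "a \<in> Arr (full_sub C D)" "b \<in> Arr (full_sub C D)"
    using cov_cover assms by blast+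
  ultimately show ?thesis
    using assms cov_Dom cov_Cod unfolding epic_def by (auto simp: full_sub_def)
qed

lemma deg_cmp: "cov f X Y \<Longrightarrow> cov g Y Z \<Longrightarrow> deg (g \<odot> f) = deg g * deg f"
  by (rule G4_mult) (simp_all add: cov_def arrow_def)

lemma deg_pos: "cov f X Y \<Longrightarrow> 0 < deg f"
  using G4_pos by (auto simp: cov_def arrow_def)

text \<open>Multiplicativity makes the degree equal to its own square, and it is positive.\<close>

lemma deg_Id:
  assumes "X \<in> D"
  shows "deg (Id C X) = 1"
  using deg_cmp[OF cov_Id[OF assms] cov_Id[OF assms]] deg_pos[OF cov_Id[OF assms]]
    cov_Cmp_Id[OF cov_Id[OF assms]] by simp

text \<open>By multiplicativity \<open>deg k * deg h = 1\<close> in the natural numbers, which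
  forces both factors to be 1.\<close>

lemma deg_section:
  assumes "cov h X Y" "cov k Y X" "k \<odot> h = Id C X"
  shows "deg k = 1"
  using deg_cmp[OF assms(1,2)] deg_Id cov_Dom_in[OF assms(1)] assms(3) by simp

section \<open>Factorization through components\<close>

lemma Sig_arrow:
  assumes "arrow p U B" "i \<in> Sig U"
  obtains W where "arrow i W U" "W \<in> D"
  using assms G3_Sig Dom_Obj unfolding arrow_def by metis

lemma cov_component:
  assumes "arrow p U B" "B \<in> D" "i \<in> Sig U"
  obtains W where "arrow i W U" "cov (p \<odot> i) W B"
  using Sig_arrow[OF assms(1,3)] arrow_cmp assms unfolding cov_def by metis

text \<open>The component comes from \<open>G3_unique\<close>; the factor \<open>h\<close> is a
  cover because \<open>D\<close> is full and both of its ends lie in \<open>D\<close>.\<close>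

lemma factor_Sig:
  assumes "arrow u X U" "X \<in> D"
  obtains i h where "i \<in> Sig U" "cov h X (Dom C i)" "u = i \<odot> h"
proof -
  have U: "U \<in> Obj C"
    using assms Cod_Obj by (auto simp: arrow_def)
  obtain i where i: "i \<in> Sig U" "Hom_over C u i \<noteq> {}"
    using G3_unique[OF U, of u] assms by (auto simp: arrow_def)
  then obtain h where h: "h \<in> Arr C" "Cod C h = Dom C i" "u = i \<odot> h"
    by (auto simp: Hom_over_def)
  have "i \<in> Arr C" "Dom C i \<in> D"
    using G3_Sig U i by auto
  then have "cov h X (Dom C i)"
    using h assms Dom_Cmp by (auto simp: cov_def arrow_def)
  then show thesis
    using that i h by blast
qed

lemma Sig_unique:
  assumes "i \<in> Sig U" "j \<in> Sig U" "arrow i W U" "arrow j V U"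
    and "cov x X W" "cov y X V" "i \<odot> x = j \<odot> y"
  shows "i = j"
proof -
  have "U \<in> Obj C"
    using assms(3) Cod_Obj by (auto simp: arrow_def)
  moreover have "arrow (i \<odot> x) X U" "X \<in> D"
    using arrow_cmp assms by (auto simp: cov_def)
  moreover have "x \<in> Hom_over C (i \<odot> x) i" "y \<in> Hom_over C (i \<odot> x) j"
    using assms by (auto simp: Hom_over_def cov_def arrow_def)
  ultimately show ?thesis
    using G3_unique[of U "i \<odot> x"] assms(1,2) unfolding arrow_def by blast
qed

text \<open>The arrow \<open>s\<close> runs through some component \<open>j\<close>. Precomposed
  with \<open>y\<close> it also runs through \<open>i\<close>, so \<open>j = i\<close> by
  \<open>Sig_unique\<close>. An object of \<open>D\<close> thus behaves as connected: one commuting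
  square decides in which component all of \<open>s\<close> lies.\<close>

lemma factor_same_component:
  assumes "i \<in> Sig U" "arrow i W U" "cov x X W" "arrow s Z U" "cov y X Z" "i \<odot> x = s \<odot> y"
  obtains w where "cov w Z W" "s = i \<odot> w"
proof -
  have Z: "Z \<in> D"
    using assms(5) cov_Cod_in by blast
  obtain j h where j: "j \<in> Sig U" "cov h Z (Dom C j)" "s = j \<odot> h"
    using factor_Sig[OF assms(4) Z] by blast
  have aj: "arrow j (Dom C j) U"
    using Sig_arrow[OF assms(4)] j Sig_arrow[of s U] assms(2,4) G3_Sig[of U j] Cod_Obj
    unfolding arrow_def by metis
  have "i \<odot> x = j \<odot> (h \<odot> y)"
    using assms(6) j arrow_assoc[OF cov_arrow[OF assms(5)] cov_arrow[OF j(2)] aj] by simp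
  then have "i = j"
    using Sig_unique[OF assms(1) j(1) assms(2) aj assms(3) cov_cmp[OF assms(5) j(2)]] by blast
  then show thesis
    using that j assms(2) by (auto simp: arrow_def)
qed

section \<open>Pullbacks of covers\<close>

definition pullback :: "'a \<Rightarrow> 'a \<Rightarrow> 'o \<Rightarrow> 'a \<Rightarrow> 'a \<Rightarrow> bool" where
  "pullback f g U p q \<longleftrightarrow> is_pullback C f g p q \<and> Dom C p = U"

lemma pullback_arrows:
  assumes "pullback f g U p q" "cov f X A" "cov g Y A"
  shows "arrow p U X" "arrow q U Y" "f \<odot> p = g \<odot> q"
  using assms by (auto simp: pullback_def is_pullback_def arrow_def cov_def)

lemma pullback_ex:
  assumes "cov f X A" "cov g Y A"
  obtains U p q where "pullback f g U p q"
  using G1[of f g] assms cov_cover cov_Cod unfolding pullback_def by metis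

lemma pullback_factor_unique:
  assumes pb: "pullback f g U p q" and f: "cov f X A" and g: "cov g Y A"
    and x: "arrow x Z X" and y: "arrow y Z Y" and eq: "f \<odot> x = g \<odot> y"
  shows "\<exists>!u. arrow u Z U \<and> p \<odot> u = x \<and> q \<odot> u = y"
proof -
  have univ: "\<forall>x\<in>Arr C. \<forall>y\<in>Arr C.
      Dom C x = Dom C y \<and> Cod C x = Dom C f \<and> Cod C y = Dom C g \<and> f \<odot> x = g \<odot> y \<longrightarrow>
      (\<exists>!u. u \<in> Arr C \<and> Dom C u = Dom C x \<and> Cod C u = Dom C p \<and> p \<odot> u = x \<and> q \<odot> u = y)"
    using pb unfolding pullback_def is_pullback_def by (elim conjE) assumption
  have xy: "x \<in> Arr C" "y \<in> Arr C" and Dom: "Dom C x = Z" "Dom C p = U"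
    using x y pb by (simp_all add: arrow_def pullback_def)
  have "Dom C x = Dom C y \<and> Cod C x = Dom C f \<and> Cod C y = Dom C g \<and> f \<odot> x = g \<odot> y"
    using x y f g eq by (simp add: cov_def arrow_def)
  from mp[OF bspec[OF bspec[OF univ xy(1)] xy(2)] this] show ?thesis
    by (simp add: arrow_def Dom conj_assoc)
qed

lemma pullback_factor:
  assumes "pullback f g U p q" "cov f X A" "cov g Y A" "cov x Z X" "cov y Z Y" "f \<odot> x = g \<odot> y"
  obtains u where "arrow u Z U" "p \<odot> u = x" "q \<odot> u = y"
  using pullback_factor_unique[OF assms(1-3) cov_arrow[OF assms(4)] cov_arrow[OF assms(5)] assms(6)]
  by blast

lemma pullback_unique:
  assumes pb: "pullback f g U p q" and f: "cov f X A" and g: "cov g Y A"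
    and u: "arrow u Z U" and v: "arrow v Z U"
    and eq: "p \<odot> u = p \<odot> v" "q \<odot> u = q \<odot> v"
  shows "u = v"
proof -
  note ar = pullback_arrows[OF pb f g]
  have a: "arrow (p \<odot> u) Z X" "arrow (q \<odot> u) Z Y"
    using arrow_cmp u ar by blast+
  have "f \<odot> (p \<odot> u) = g \<odot> (q \<odot> u)"
    using arrow_assoc[OF u ar(1) cov_arrow[OF f]] arrow_assoc[OF u ar(2) cov_arrow[OF g]] ar(3)
    by simp
  then show ?thesis
    using pullback_factor_unique[OF pb f g a] u v eq by auto
qed

lemma pullback_deg:
  assumes "pullback f g U p q" "cov f X A" "cov g Y A"
  shows "deg f = deg q" "deg g = deg p"
proof -
  have "is_pullback C f g p q"
    using assms(1) unfolding pullback_def by blast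
  from G4_pullback[OF cov_cover[OF assms(2)] cov_cover[OF assms(3)] this]
  show "deg f = deg q" "deg g = deg p"
    by auto
qed

section \<open>Degrees of the components of a pullback\<close>

lemma deg_sum:
  assumes "arrow p U B" "B \<in> D"
  shows "deg p = (\<Sum>i\<in>Sig U. deg (p \<odot> i))"
proof -
  have p: "p \<in> Arr C" "Cod C p \<in> D" "Dom C p = U"
    using assms by (simp_all add: arrow_def)
  show ?thesis
    using G4_sum[OF p(1,2)] unfolding p(3) .
qed

lemma deg_arrow_pos: "arrow p U B \<Longrightarrow> B \<in> D \<Longrightarrow> 0 < deg p"
  using G4_pos by (auto simp: arrow_def)

text \<open>A sum over an infinite set has the value 0, whereas \<open>deg p\<close> is positive.
  The arrow \<open>p\<close> into \<open>D\<close> gives access to the degree axioms, which speak of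
  \<open>Sig U\<close> only through such arrows.\<close>

lemma finite_Sig:
  assumes "arrow p U B" "B \<in> D"
  shows "finite (Sig U)"
proof (rule ccontr)
  assume "infinite (Sig U)"
  then show False
    using deg_sum[OF assms] deg_arrow_pos[OF assms] by simp
qed

lemma Sig_nonempty:
  assumes "arrow p U B" "B \<in> D"
  shows "Sig U \<noteq> {}"
proof
  assume "Sig U = {}"
  then show False
    using deg_sum[OF assms] deg_arrow_pos[OF assms] by simp
qed

text \<open>Any component of the pullback, composed with the two projections, completes the cospan
  to a square of covers; a component exists by \<open>Sig_nonempty\<close>.\<close>

lemma amalgamation:
  assumes "cov f X A" "cov g Y A"
  obtains x y Z where "cov x Z X" "cov y Z Y" "f \<odot> x = g \<odot> y"
proof -
  obtain U p q where pb: "pullback f g U p q"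
    using pullback_ex assms by blast
  note ar = pullback_arrows[OF pb assms]
  have XY: "X \<in> D" "Y \<in> D"
    using assms by (auto simp: cov_def)
  obtain i where i: "i \<in> Sig U"
    using Sig_nonempty ar(1) XY by blast
  obtain W where W: "arrow i W U" "cov (p \<odot> i) W X"
    using cov_component[OF ar(1) XY(1) i] .
  obtain V where V: "arrow i V U" "cov (q \<odot> i) V Y"
    using cov_component[OF ar(2) XY(2) i] .
  have "V = W"
    using V W by (auto simp: arrow_def)
  moreover have "f \<odot> (p \<odot> i) = g \<odot> (q \<odot> i)"
    using arrow_assoc[OF W(1) ar(1) cov_arrow[OF assms(1)]]
      arrow_assoc[OF W(1) ar(2) cov_arrow[OF assms(2)]] ar(3) by simp
  ultimately show thesis
    using that W V by blast
qed

text \<open>The diagonal \<open>u\<close>, induced by two identities, starts in \<open>D\<close> and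
  so factors through a component \<open>i\<close>. The factor \<open>h\<close> is a section of
  \<open>p \<odot> i\<close>, whence the degree 1.\<close>

lemma diagonal_component:
  assumes pb: "pullback f f U p q" and f: "cov f B A"
  obtains i W h where "i \<in> Sig U" "arrow i W U" "cov h B W" "(p \<odot> i) \<odot> h = Id C B"
    "(q \<odot> i) \<odot> h = Id C B" "deg (p \<odot> i) = 1"
proof -
  note ar = pullback_arrows[OF pb f f]
  have B: "B \<in> D"
    using f by (auto simp: cov_def)
  obtain u where u: "arrow u B U" "p \<odot> u = Id C B" "q \<odot> u = Id C B"
    using pullback_factor[OF pb f f cov_Id[OF B] cov_Id[OF B]] by blast
  obtain i h where i: "i \<in> Sig U" "cov h B (Dom C i)" "u = i \<odot> h"
    using factor_Sig[OF u(1) B] .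
  obtain W where W: "arrow i W U" "cov (p \<odot> i) W B"
    using cov_component[OF ar(1) B i(1)] .
  have h: "cov h B W"
    using i(2) W(1) by (auto simp: arrow_def)
  have "(p \<odot> i) \<odot> h = Id C B" "(q \<odot> i) \<odot> h = Id C B"
    using arrow_assoc[OF cov_arrow[OF h] W(1)] ar u i(3) by auto
  then show thesis
    using that i(1) W h deg_section[OF h W(2)] by blast
qed

text \<open>The degrees of all components sum to \<open>deg p = deg f\<close>, and the diagonal
  component \<open>j\<close> uses up 1 of this total.\<close>

lemma deg_component_less:
  assumes pb: "pullback f f U p q" and f: "cov f B A" and deg: "2 < deg f" and i: "i \<in> Sig U"
  shows "deg (p \<odot> i) < deg f"
proof -
  note ar = pullback_arrows[OF pb f f]
  have B: "B \<in> D"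
    using f by (auto simp: cov_def)
  obtain j where j: "j \<in> Sig U" "deg (p \<odot> j) = 1"
    using diagonal_component[OF pb f] by blast
  show ?thesis
  proof (cases "i = j")
    case True
    then show ?thesis using j deg by simp
  next
    case False
    have "deg (p \<odot> i) + deg (p \<odot> j) = (\<Sum>k\<in>{i, j}. deg (p \<odot> k))"
      using False by simp
    also have "\<dots> \<le> (\<Sum>k\<in>Sig U. deg (p \<odot> k))"
      using finite_Sig[OF ar(1) B] i j by (intro sum_mono2) auto
    also have "\<dots> = deg f"
      using deg_sum[OF ar(1) B] pullback_deg(2)[OF pb f f] by simp
    finally show ?thesis using j by simp
  qed
qed

text \<open>Next to the diagonal component, a total of at most 2 leaves at most 1 for any other
  component. This is what makes the base case of the algorithm correct.\<close>

lemma deg_component_small: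
  assumes pb: "pullback f f U p q" and f: "cov f B A" and deg: "deg f \<le> 2" and i: "i \<in> Sig U"
  shows "deg (p \<odot> i) = 1"
proof -
  note ar = pullback_arrows[OF pb f f]
  have B: "B \<in> D"
    using f by (auto simp: cov_def)
  obtain j where j: "j \<in> Sig U" "deg (p \<odot> j) = 1"
    using diagonal_component[OF pb f] by blast
  have pos: "0 < deg (p \<odot> i)"
    using cov_component[OF ar(1) B i] deg_pos by metis
  show ?thesis
  proof (cases "i = j")
    case False
    have "deg (p \<odot> i) + deg (p \<odot> j) = (\<Sum>k\<in>{i, j}. deg (p \<odot> k))"
      using False by simp
    also have "\<dots> \<le> (\<Sum>k\<in>Sig U. deg (p \<odot> k))"
      using finite_Sig[OF ar(1) B] i j by (intro sum_mono2) auto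
    also have "\<dots> = deg f"
      using deg_sum[OF ar(1) B] pullback_deg(2)[OF pb f f] by simp
    finally show ?thesis using j deg pos by simp
  qed (use j in simp)
qed

section \<open>Isomorphisms among covers\<close>

lemma cov_inverse:
  assumes k: "cov k X Y"
    and mono: "\<forall>x y Z. cov x Z X \<longrightarrow> cov y Z X \<longrightarrow> k \<odot> x = k \<odot> y \<longrightarrow> x = y"
  obtains v where "cov v Y X" "v \<odot> k = Id C X" "k \<odot> v = Id C Y" "iso C k"
proof -
  have "monic (full_sub C D) k"
    unfolding monic_def
    using mono cov_cover[OF k] cov_Dom[OF k] by (auto simp: full_sub_def cov_def arrow_def)
  then obtain v where v: "inverse_arrows C k v" "cover C D v"
    using G2_monic by blast
  have "iso C k"
    using v(1) unfolding iso_def by blast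
  moreover have "cov v Y X" "v \<odot> k = Id C X" "k \<odot> v = Id C Y"
    using v k unfolding inverse_arrows_def cover_iff_cov by (auto simp: cov_def arrow_def)
  ultimately show thesis
    using that by blast
qed

text \<open>A split monic is monic, so \<open>h\<close> has an inverse \<open>v\<close> by
  \<open>G2_monic\<close>; as \<open>h\<close> is also epic,
  \<open>k \<odot> h = v \<odot> h\<close> gives \<open>k = v\<close>.\<close>

lemma split_mono_inverse:
  assumes h: "cov h X Y" and k: "cov k Y X" and kh: "k \<odot> h = Id C X"
  shows "h \<odot> k = Id C Y"
proof -
  have mono: "\<forall>x y Z. cov x Z X \<longrightarrow> cov y Z X \<longrightarrow> h \<odot> x = h \<odot> y \<longrightarrow> x = y"
  proof (intro allI impI)
    fix x y Z
    assume xy: "cov x Z X" "cov y Z X" "h \<odot> x = h \<odot> y"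
    show "x = y"
      using cov_assoc[OF xy(1) h k] cov_assoc[OF xy(2) h k] kh xy(3) cov_Id_Cmp[OF xy(1)]
        cov_Id_Cmp[OF xy(2)] by simp
  qed
  obtain v where v: "cov v Y X" "v \<odot> h = Id C X" "h \<odot> v = Id C Y"
    using cov_inverse[OF h mono] by blast
  have "k = v"
    using cov_epic[OF h k v(1)] v kh by simp
  then show ?thesis using v by simp
qed

text \<open>The pullback of \<open>k\<close> along itself has total degree 1, so the diagonal
  component is its only one. The projections agree there, hence any two covers identified by
  \<open>k\<close> agree, and \<open>k\<close> is monic in \<open>D\<close>.\<close>

lemma deg_1_inverse:
  assumes k: "cov k X Y" and deg: "deg k = 1"
  obtains v where "cov v Y X" "v \<odot> k = Id C X" "k \<odot> v = Id C Y" "iso C k"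
proof -
  obtain U p q where pb: "pullback k k U p q"
    using pullback_ex k by blast
  note ar = pullback_arrows[OF pb k k]
  have X: "X \<in> D"
    using k by (auto simp: cov_def)
  obtain i W h where i: "i \<in> Sig U" "arrow i W U" "cov h X W" "(p \<odot> i) \<odot> h = Id C X"
    "(q \<odot> i) \<odot> h = Id C X"
    using diagonal_component[OF pb k] by blast
  have one: "(\<Sum>j\<in>Sig U. deg (p \<odot> j)) = 1"
    using deg_sum[OF ar(1) X] pullback_deg(2)[OF pb k k] deg by simp
  have single: "j = i" if j: "j \<in> Sig U" for j
  proof (rule ccontr)
    assume "j \<noteq> i"
    then have "deg (p \<odot> i) + deg (p \<odot> j) = (\<Sum>k\<in>{i, j}. deg (p \<odot> k))"
      by simp
    also have "\<dots> \<le> (\<Sum>k\<in>Sig U. deg (p \<odot> k))"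
      using finite_Sig[OF ar(1) X] i j by (intro sum_mono2) auto
    finally have "deg (p \<odot> i) + deg (p \<odot> j) \<le> 1"
      using one by simp
    moreover have "0 < deg (p \<odot> i)" "0 < deg (p \<odot> j)"
      using cov_component[OF ar(1) X] deg_pos i j by metis+
    ultimately show False by simp
  qed
  have pi: "cov (p \<odot> i) W X" and qi: "cov (q \<odot> i) W X"
    using arrow_cmp[OF i(2)] ar X i(3) by (auto simp: cov_def)
  \<comment> \<open>Both composites are left inverses of \<open>h\<close>, hence two-sided inverses,
    hence equal.\<close>
  have "p \<odot> i = q \<odot> i"
  proof -
    have "h \<odot> (p \<odot> i) = Id C W" "h \<odot> (q \<odot> i) = Id C W"
      using split_mono_inverse[OF i(3)] pi qi i by blast+
    then show ?thesis
      using cov_assoc[OF pi i(3) pi] cov_assoc[OF qi i(3) pi] i(4)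
        cov_Cmp_Id[OF pi] cov_Id_Cmp[OF qi] cov_Id_Cmp[OF pi] by simp
  qed
  have "\<forall>x y Z. cov x Z X \<longrightarrow> cov y Z X \<longrightarrow> k \<odot> x = k \<odot> y \<longrightarrow> x = y"
  proof (intro allI impI)
    fix x y Z
    assume xy: "cov x Z X" "cov y Z X" "k \<odot> x = k \<odot> y"
    obtain u where u: "arrow u Z U" "p \<odot> u = x" "q \<odot> u = y"
      using pullback_factor[OF pb k k xy] .
    obtain j h where j: "j \<in> Sig U" "cov h Z (Dom C j)" "u = j \<odot> h"
      using factor_Sig[OF u(1)] xy(1) cov_Dom_in by blast
    have "j = i"
      using single j(1) .
    then have h: "cov h Z W"
      using j i(2) by (auto simp: arrow_def)
    show "x = y"
      using u j(3) \<open>j = i\<close> arrow_assoc[OF cov_arrow[OF h] i(2) ar(1)]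
        arrow_assoc[OF cov_arrow[OF h] i(2) ar(2)] \<open>p \<odot> i = q \<odot> i\<close> by simp
  qed
  from cov_inverse[OF k this] that show thesis
    by blast
qed

section \<open>Splitting covers\<close>

text \<open>In the dual picture of field extensions, with \<open>f\<close> for L/K and
  \<open>g\<close> for N/K, this says that every K-embedding of L into an extension of N lands in N.
  Accordingly \<open>splits f f\<close> is normality.\<close>

definition splits :: "'a \<Rightarrow> 'a \<Rightarrow> bool" where
  "splits g f \<longleftrightarrow> (\<forall>x y X. cov x X (Dom C g) \<and> cov y X (Dom C f) \<and> g \<odot> x = f \<odot> y \<longrightarrow>
    (\<exists>h. cov h (Dom C g) (Dom C f) \<and> f \<odot> h = g \<and> h \<odot> x = y))"

text \<open>The equation \<open>f \<odot> h = g\<close> need not be supplied: it holds after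
  composition with \<open>x\<close>, which is epic.\<close>

lemma splitsI:
  assumes "cov g Y A" "cov f B A"
    and "\<And>x y X. cov x X Y \<Longrightarrow> cov y X B \<Longrightarrow> g \<odot> x = f \<odot> y \<Longrightarrow> \<exists>h. cov h Y B \<and> h \<odot> x = y"
  shows "splits g f"
  unfolding splits_def
proof (intro allI impI)
  fix x y X
  assume "cov x X (Dom C g) \<and> cov y X (Dom C f) \<and> g \<odot> x = f \<odot> y"
  then have xy: "cov x X Y" "cov y X B" "g \<odot> x = f \<odot> y"
    using cov_Dom[OF assms(1)] cov_Dom[OF assms(2)] by simp_all
  obtain h where h: "cov h Y B" "h \<odot> x = y"
    using assms(3)[OF xy] by blast
  have "f \<odot> h = g"
    using cov_epic[OF xy(1) cov_cmp[OF h(1) assms(2)] assms(1)] cov_assoc[OF xy(1) h(1) assms(2)]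
      h xy by simp
  then show "\<exists>h. cov h (Dom C g) (Dom C f) \<and> f \<odot> h = g \<and> h \<odot> x = y"
    using h cov_Dom[OF assms(1)] cov_Dom[OF assms(2)] by auto
qed

lemma splitsE:
  assumes "splits g f" "cov g Y A" "cov f B A" "cov x X Y" "cov y X B" "g \<odot> x = f \<odot> y"
  obtains h where "cov h Y B" "f \<odot> h = g" "h \<odot> x = y"
  using assms cov_Dom[OF assms(2)] cov_Dom[OF assms(3)] unfolding splits_def by blast

text \<open>By \<open>amalgamation\<close> there is at least one square to which the splitting
  property applies.\<close>

lemma splits_ex_factor:
  assumes "splits g f" "cov g Y A" "cov f B A"
  obtains h where "cov h Y B" "f \<odot> h = g"
proof -
  obtain x y Z where xy: "cov x Z Y" "cov y Z B" "g \<odot> x = f \<odot> y"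
    using amalgamation[OF assms(2,3)] .
  show thesis
    using splitsE[OF assms xy] that by blast
qed

text \<open>The pair \<open>x, y\<close> factors through a component \<open>i\<close>. As
  \<open>p \<odot> i\<close> has an inverse \<open>v\<close>, the arrow
  \<open>(q \<odot> i) \<odot> v\<close> takes \<open>x\<close> to \<open>y\<close>.\<close>

lemma splits_if_components:
  assumes pb: "pullback f f U p q" and f: "cov f B A" and deg: "\<And>i. i \<in> Sig U \<Longrightarrow> deg (p \<odot> i) = 1"
  shows "splits f f"
proof (rule splitsI[OF f f])
  fix x y X
  assume xy: "cov x X B" "cov y X B" "f \<odot> x = f \<odot> y"
  note ar = pullback_arrows[OF pb f f]
  have B: "B \<in> D"
    using f by (auto simp: cov_def)
  obtain u where u: "arrow u X U" "p \<odot> u = x" "q \<odot> u = y"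
    using pullback_factor[OF pb f f xy] .
  obtain i z where i: "i \<in> Sig U" "cov z X (Dom C i)" "u = i \<odot> z"
    using factor_Sig[OF u(1)] xy(1) cov_Dom_in by blast
  obtain W where W: "arrow i W U" "cov (p \<odot> i) W B"
    using cov_component[OF ar(1) B i(1)] .
  have z: "cov z X W"
    using i W by (auto simp: arrow_def)
  have qi: "cov (q \<odot> i) W B"
    using arrow_cmp[OF W(1) ar(2)] B W(2) by (auto simp: cov_def)
  obtain v where v: "cov v B W" "v \<odot> (p \<odot> i) = Id C W"
    using deg_1_inverse[OF W(2) deg[OF i(1)]] by blast
  have "v \<odot> x = z"
    using cov_assoc[OF z W(2) v(1)] v(2) cov_Id_Cmp[OF z] u(2) i(3)
      arrow_assoc[OF cov_arrow[OF z] W(1) ar(1)] by simp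
  then have "((q \<odot> i) \<odot> v) \<odot> x = y"
    using cov_assoc[OF xy(1) v(1) qi] arrow_assoc[OF cov_arrow[OF z] W(1) ar(2)] u(3) i(3) by simp
  then show "\<exists>h. cov h B B \<and> h \<odot> x = y"
    using cov_cmp[OF v(1) qi] by blast
qed

text \<open>Splitting, applied to the two projections of \<open>i\<close>, gives \<open>h\<close>
  with \<open>h \<odot> (p \<odot> i) = q \<odot> i\<close>. The graph \<open>s\<close> of
  \<open>h\<close> then satisfies \<open>s \<odot> (p \<odot> i) = i\<close>, so it runs through
  \<open>i\<close> and yields a section of \<open>p \<odot> i\<close>.\<close>

lemma components_if_splits:
  assumes pb: "pullback f f U p q" and f: "cov f B A" and sp: "splits f f" and i: "i \<in> Sig U"
  shows "deg (p \<odot> i) = 1"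
proof -
  note ar = pullback_arrows[OF pb f f]
  have B: "B \<in> D"
    using f by (auto simp: cov_def)
  obtain W where W: "arrow i W U" "cov (p \<odot> i) W B"
    using cov_component[OF ar(1) B i] .
  have qi: "cov (q \<odot> i) W B"
    using arrow_cmp[OF W(1) ar(2)] B W(2) by (auto simp: cov_def)
  have "f \<odot> (p \<odot> i) = f \<odot> (q \<odot> i)"
    using arrow_assoc[OF W(1) ar(1) cov_arrow[OF f]] arrow_assoc[OF W(1) ar(2) cov_arrow[OF f]] ar(3)
    by simp
  then obtain h where h: "cov h B B" "f \<odot> h = f" "h \<odot> (p \<odot> i) = q \<odot> i"
    using splitsE[OF sp f f W(2) qi] by blast
  obtain s where s: "arrow s B U" "p \<odot> s = Id C B" "q \<odot> s = h"
    using pullback_factor[OF pb f f cov_Id[OF B] h(1)] cov_Cmp_Id[OF f] h(2) by auto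
  have "s \<odot> (p \<odot> i) = i"
  proof (rule pullback_unique[OF pb f f _ W(1)])
    show "arrow (s \<odot> (p \<odot> i)) W U"
      using arrow_cmp s(1) W(2) cov_arrow by blast
    show "p \<odot> (s \<odot> (p \<odot> i)) = p \<odot> i"
      using arrow_assoc[OF cov_arrow[OF W(2)] s(1) ar(1)] s(2) cov_Id_Cmp[OF W(2)] by simp
    show "q \<odot> (s \<odot> (p \<odot> i)) = q \<odot> i"
      using arrow_assoc[OF cov_arrow[OF W(2)] s(1) ar(2)] s(3) h(3) by simp
  qed
  then have "i \<odot> Id C W = s \<odot> (p \<odot> i)"
    using W(1) Cmp_Id by (auto simp: arrow_def)
  then obtain w where w: "cov w B W" "s = i \<odot> w"
    using factor_same_component[OF i W(1) cov_Id[OF cov_Dom_in[OF W(2)]] s(1) W(2)] by blast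
  have "(p \<odot> i) \<odot> w = Id C B"
    using arrow_assoc[OF cov_arrow[OF w(1)] W(1) ar(1)] w(2) s(2) by simp
  then show ?thesis
    using deg_section[OF w(1) W(2)] by blast
qed

section \<open>Automorphisms and Galois covers\<close>

lemma Hom_over_cov:
  assumes "cov f B A" "cov g Y A"
  shows "Hom_over C g f = {h. cov h Y B \<and> f \<odot> h = g}"
proof (intro set_eqI iffI)
  fix h assume "h \<in> Hom_over C g f"
  then have h: "h \<in> Arr C" "Cod C h = B" "g = f \<odot> h"
    using cov_Dom[OF assms(1)] by (auto simp: Hom_over_def)
  have "Dom C g = Dom C h"
    using Dom_Cmp[of h f] h assms(1) by (simp add: cov_def arrow_def)
  then show "h \<in> {h. cov h Y B \<and> f \<odot> h = g}"
    using h assms by (simp add: cov_def arrow_def)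
next
  fix h assume "h \<in> {h. cov h Y B \<and> f \<odot> h = g}"
  then show "h \<in> Hom_over C g f"
    using cov_Dom[OF assms(1)] by (auto simp: Hom_over_def cov_def arrow_def)
qed

text \<open>From \<open>f \<odot> h = f\<close> multiplicativity gives \<open>deg h = 1\<close>, so
  every endomorphism is invertible.\<close>

lemma Aut_cov:
  assumes f: "cov f B A"
  shows "Aut C f = {h. cov h B B \<and> f \<odot> h = f}"
proof -
  have "iso C h" if "cov h B B" "f \<odot> h = f" for h
    using deg_cmp[OF that(1) f] deg_pos[OF f] deg_1_inverse[OF that(1)] that(2) by auto
  then show ?thesis
    unfolding Aut_def Hom_over_cov[OF f f] by blast
qed

text \<open>A component \<open>i\<close> of degree 1 is the graph of the automorphism
  \<open>F i\<close> with \<open>F i \<odot> (p \<odot> i) = q \<odot> i\<close>. Conversely, the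
  graph of an automorphism runs through exactly one component, which then has degree 1.\<close>

lemma card_Aut:
  assumes pb: "pullback f f U p q" and f: "cov f B A"
  shows "finite (Aut C f)" "card (Aut C f) = card {i \<in> Sig U. deg (p \<odot> i) = 1}"
proof -
  note ar = pullback_arrows[OF pb f f]
  define I where "I = {i \<in> Sig U. deg (p \<odot> i) = 1}"
  have B: "B \<in> D"
    using f by (auto simp: cov_def)
  have comp: "\<exists>W. arrow i W U \<and> cov (p \<odot> i) W B \<and> cov (q \<odot> i) W B" if i: "i \<in> Sig U" for i
  proof -
    obtain W where W: "arrow i W U" "cov (p \<odot> i) W B"
      using cov_component[OF ar(1) B i] .
    then show ?thesis
      using arrow_cmp[OF W(1) ar(2)] B by (auto simp: cov_def)
  qed
  have "\<exists>h\<in>Aut C f. h \<odot> (p \<odot> i) = q \<odot> i" if i: "i \<in> I" for i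
  proof -
    obtain W where W: "arrow i W U" "cov (p \<odot> i) W B" "cov (q \<odot> i) W B"
      using comp i unfolding I_def by blast
    obtain v where v: "cov v B W" "v \<odot> (p \<odot> i) = Id C W"
      using deg_1_inverse[OF W(2)] i unfolding I_def by auto
    have h: "cov ((q \<odot> i) \<odot> v) B B"
      using cov_cmp v W by blast
    have hp: "((q \<odot> i) \<odot> v) \<odot> (p \<odot> i) = q \<odot> i"
      using cov_assoc[OF W(2) v(1) W(3)] v(2) cov_Cmp_Id[OF W(3)] by simp
    have "f \<odot> (p \<odot> i) = f \<odot> (q \<odot> i)"
      using arrow_assoc[OF W(1) ar(1) cov_arrow[OF f]] arrow_assoc[OF W(1) ar(2) cov_arrow[OF f]] ar(3)
    by simp
    then have "(f \<odot> ((q \<odot> i) \<odot> v)) \<odot> (p \<odot> i) = f \<odot> (p \<odot> i)"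
      using cov_assoc[OF W(2) h f] hp by simp
    then have "f \<odot> ((q \<odot> i) \<odot> v) = f"
      using cov_epic[OF W(2) cov_cmp[OF h f] f] by blast
    then show ?thesis
      using h hp unfolding Aut_cov[OF f] by blast
  qed
  then have "\<forall>i\<in>I. \<exists>h. h \<in> Aut C f \<and> h \<odot> (p \<odot> i) = q \<odot> i"
    by blast
  from bchoice[OF this] obtain F
    where F: "\<And>i. i \<in> I \<Longrightarrow> F i \<in> Aut C f" "\<And>i. i \<in> I \<Longrightarrow> F i \<odot> (p \<odot> i) = q \<odot> i"
    by blast
  have graph: "\<exists>s j w. arrow s B U \<and> p \<odot> s = Id C B \<and> q \<odot> s = h \<and> j \<in> Sig U \<and>
      cov w B (Dom C j) \<and> s = j \<odot> w"
    if h: "h \<in> Aut C f" for h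
  proof -
    have h: "cov h B B" "f \<odot> h = f"
      using h unfolding Aut_cov[OF f] by blast+
    obtain s where s: "arrow s B U" "p \<odot> s = Id C B" "q \<odot> s = h"
      using pullback_factor[OF pb f f cov_Id[OF B] h(1)] cov_Cmp_Id[OF f] h(2) by auto
    obtain j w where "j \<in> Sig U" "cov w B (Dom C j)" "s = j \<odot> w"
      using factor_Sig[OF s(1) B] .
    then show ?thesis
      using s by blast
  qed
  \<comment> \<open>This gives injectivity: the graph \<open>s\<close> of \<open>F i\<close>
    satisfies \<open>s \<odot> (p \<odot> i) = i\<close>, so a component \<open>j\<close> through
    which \<open>s\<close> runs can only be \<open>i\<close>.\<close>
  have determined: "i = j"
    if s: "arrow s B U" "p \<odot> s = Id C B" "s = j \<odot> w" and j: "j \<in> Sig U" and w: "cov w B (Dom C j)"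
      and i: "i \<in> I" "F i = q \<odot> s" for i s j w
  proof -
    have iS: "i \<in> Sig U"
      using i unfolding I_def by blast
    obtain W where W: "arrow i W U" "cov (p \<odot> i) W B" "cov (q \<odot> i) W B"
      using comp iS by blast
    have aj: "arrow j (Dom C j) U"
      using comp[OF j] unfolding arrow_def by auto
    have "s \<odot> (p \<odot> i) = i"
    proof (rule pullback_unique[OF pb f f _ W(1)])
      show "arrow (s \<odot> (p \<odot> i)) W U"
        using arrow_cmp s(1) W(2) cov_arrow by blast
      show "p \<odot> (s \<odot> (p \<odot> i)) = p \<odot> i"
        using arrow_assoc[OF cov_arrow[OF W(2)] s(1) ar(1)] s(2) cov_Id_Cmp[OF W(2)] by simp
      show "q \<odot> (s \<odot> (p \<odot> i)) = q \<odot> i"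
        using arrow_assoc[OF cov_arrow[OF W(2)] s(1) ar(2)] i(2) F(2)[OF i(1)] by simp
    qed
    moreover have "i \<odot> Id C W = i"
      using W(1) Cmp_Id by (auto simp: arrow_def)
    ultimately have "i \<odot> Id C W = j \<odot> (w \<odot> (p \<odot> i))"
      using arrow_assoc[OF cov_arrow[OF W(2)] cov_arrow[OF w] aj] s(3) by simp
    then show ?thesis
      using Sig_unique[OF iS j W(1) aj cov_Id[OF cov_Dom_in[OF W(2)]] cov_cmp[OF W(2) w]] by blast
  qed
  have "bij_betw F I (Aut C f)"
  proof (rule bij_betw_imageI)
    show "inj_on F I"
    proof (rule inj_onI)
      fix i j assume ij: "i \<in> I" "j \<in> I" "F i = F j"
      obtain s k w where s: "arrow s B U" "p \<odot> s = Id C B" "q \<odot> s = F i" "k \<in> Sig U"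
          "cov w B (Dom C k)" "s = k \<odot> w"
        using graph[OF F(1)[OF ij(1)]] by blast
      have "i = k"
        using determined[OF s(1,2,6,4,5) ij(1)] s(3) by simp
      moreover have "j = k"
        using determined[OF s(1,2,6,4,5) ij(2)] s(3) ij(3) by simp
      ultimately show "i = j" by simp
    qed
    show "F ` I = Aut C f"
    proof
      show "Aut C f \<subseteq> F ` I"
      proof
        fix h assume h: "h \<in> Aut C f"
        then obtain s j w where s: "arrow s B U" "p \<odot> s = Id C B" "q \<odot> s = h"
            "j \<in> Sig U" "cov w B (Dom C j)" "s = j \<odot> w"
          using graph by blast
        obtain W where W: "arrow j W U" "cov (p \<odot> j) W B" "cov (q \<odot> j) W B"
          using comp s by blast
        have w: "cov w B W"
          using s W by (auto simp: arrow_def)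
        have pjw: "(p \<odot> j) \<odot> w = Id C B" and qjw: "(q \<odot> j) \<odot> w = h"
          using arrow_assoc[OF cov_arrow[OF w] W(1)] ar s by auto
        have j: "j \<in> I"
          using deg_section[OF w W(2) pjw] s(4) unfolding I_def by blast
        have Fj: "cov (F j) B B"
          using F(1)[OF j] unfolding Aut_cov[OF f] by blast
        have "F j = h"
          using cov_assoc[OF w W(2) Fj] F(2)[OF j] pjw qjw cov_Cmp_Id[OF Fj] by simp
        then show "h \<in> F ` I"
          using j by blast
      qed
    qed (use F(1) in blast)
  qed
  moreover have "finite I"
    using finite_Sig[OF ar(1) B] unfolding I_def by simp
  ultimately show "finite (Aut C f)" "card (Aut C f) = card {i \<in> Sig U. deg (p \<odot> i) = 1}"
    using bij_betw_finite[of F I] bij_betw_same_card[of F I] unfolding I_def by simp_all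
qed

text \<open>The degree of \<open>f\<close> is the sum of the component degrees, all at least 1,
  while the automorphisms count the components of degree 1. The two numbers agree exactly if every
  component has degree 1.\<close>

lemma galois_iff_splits:
  assumes f: "cov f B A"
  shows "galois C D deg f \<longleftrightarrow> splits f f"
proof -
  obtain U p q where pb: "pullback f f U p q"
    using pullback_ex f by blast
  note ar = pullback_arrows[OF pb f f]
  have B: "B \<in> D"
    using f by (auto simp: cov_def)
  note fin = finite_Sig[OF ar(1) B]
  have pos: "1 \<le> deg (p \<odot> i)" if "i \<in> Sig U" for i
    using cov_component[OF ar(1) B that] deg_pos by (metis One_nat_def Suc_leI)
  have sum: "deg f = (\<Sum>i\<in>Sig U. deg (p \<odot> i))"
    using deg_sum[OF ar(1) B] pullback_deg(2)[OF pb f f] by simp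
  have "card {i \<in> Sig U. deg (p \<odot> i) = 1} = deg f \<longleftrightarrow> (\<forall>i\<in>Sig U. deg (p \<odot> i) = 1)"
  proof
    assume eq: "card {i \<in> Sig U. deg (p \<odot> i) = 1} = deg f"
    \<comment> \<open>The number of all components is squeezed between the number of those of degree
      1 and the degree sum.\<close>
    have "deg f \<le> card (Sig U)"
      using eq fin card_mono[of "Sig U" "{i \<in> Sig U. deg (p \<odot> i) = 1}"] by auto
    then have "card (Sig U) = card {i \<in> Sig U. deg (p \<odot> i) = 1}"
      using eq sum sum_mono[of "Sig U" "\<lambda>_. 1" "\<lambda>i. deg (p \<odot> i)"] pos by simp
    then show "\<forall>i\<in>Sig U. deg (p \<odot> i) = 1"
      using card_subset_eq[OF fin, of "{i \<in> Sig U. deg (p \<odot> i) = 1}"] by auto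
  next
    assume "\<forall>i\<in>Sig U. deg (p \<odot> i) = 1"
    moreover from this have "{i \<in> Sig U. deg (p \<odot> i) = 1} = Sig U"
      by blast
    ultimately show "card {i \<in> Sig U. deg (p \<odot> i) = 1} = deg f"
      using sum by simp
  qed
  moreover have "splits f f \<longleftrightarrow> (\<forall>i\<in>Sig U. deg (p \<odot> i) = 1)"
    using splits_if_components[OF pb f] components_if_splits[OF pb f] by blast
  ultimately show ?thesis
    using card_Aut[OF pb f] cov_cover[OF f] unfolding galois_def by simp
qed

lemma splits_self_small:
  assumes "cov f B A" "deg f \<le> 2"
  shows "splits f f"
proof -
  obtain U p q where pb: "pullback f f U p q"
    using pullback_ex[OF assms(1,1)] .
  show ?thesis
    using splits_if_components[OF pb assms(1)] deg_component_small[OF pb assms] by blast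
qed

text \<open>Amalgamate \<open>y\<close> with \<open>k\<close> to
  \<open>y \<odot> u = k \<odot> v\<close>. Then \<open>x \<odot> u\<close> and \<open>v\<close>
  agree under \<open>f \<odot> k\<close>, so an endomorphism \<open>h\<close> takes one to the
  other, and \<open>k \<odot> h\<close> is the required factor once the epic \<open>u\<close> is
  cancelled.\<close>

lemma splits_cmp:
  assumes k: "cov k Y B" and f: "cov f B A" and g: "splits (f \<odot> k) (f \<odot> k)"
  shows "splits (f \<odot> k) f"
proof (rule splitsI[OF cov_cmp[OF k f] f])
  fix x y X
  assume xy: "cov x X Y" "cov y X B" "(f \<odot> k) \<odot> x = f \<odot> y"
  obtain u v Z where u: "cov u Z X" "cov v Z Y" "y \<odot> u = k \<odot> v"
    using amalgamation[OF xy(2) k] .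
  have "(f \<odot> k) \<odot> (x \<odot> u) = (f \<odot> k) \<odot> v"
    using cov_assoc[OF u(1) xy(1) cov_cmp[OF k f]] cov_assoc[OF u(1) xy(2) f] cov_assoc[OF u(2) k f]
      xy(3) u(3) by simp
  then obtain h where h: "cov h Y Y" "h \<odot> (x \<odot> u) = v"
    using splitsE[OF g cov_cmp[OF k f] cov_cmp[OF k f] cov_cmp[OF u(1) xy(1)] u(2)] by blast
  have "((k \<odot> h) \<odot> x) \<odot> u = y \<odot> u"
    using cov_assoc[OF u(1) xy(1) cov_cmp[OF h(1) k]] cov_assoc[OF cov_cmp[OF u(1) xy(1)] h(1) k]
      h(2) u(3) by simp
  then show "\<exists>h. cov h Y B \<and> h \<odot> x = y"
    using cov_epic[OF u(1) cov_cmp[OF xy(1) cov_cmp[OF h(1) k]] xy(2)] cov_cmp[OF h(1) k] by blast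
qed

lemma below_iff:
  assumes "cov f B A" "cov g Y A"
  shows "f \<sqsubseteq> g \<longleftrightarrow> (\<exists>k. cov k Y B \<and> g = f \<odot> k)"
  using assms cov_Cod unfolding below_def Hom_over_cov[OF assms] by auto

section \<open>Splitting closures\<close>

text \<open>Unlike minimality among the Galois covers below \<open>g\<close>, this universal property passes through
  the recursion.\<close>

definition splitting_closure :: "'a \<Rightarrow> 'a \<Rightarrow> bool" where
  "splitting_closure f g \<longleftrightarrow> splits g g \<and> f \<sqsubseteq> g \<and>
    (\<forall>h. cover C D h \<and> Cod C h = Cod C f \<and> splits h f \<longrightarrow> g \<sqsubseteq> h)"

text \<open>A Galois cover above \<open>f\<close> splits itself and therefore, by
  \<open>splits_cmp\<close>, splits \<open>f\<close>; so the universal property applies to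
  it.\<close>

lemma galois_closure_if_splitting_closure:
  assumes f: "cov f B A" and g: "cov g Y A" and cl: "splitting_closure f g"
  shows "galois_closure C D deg f g"
  unfolding galois_closure_def
proof (intro conjI allI impI)
  show "galois C D deg g" "f \<sqsubseteq> g"
    using cl galois_iff_splits[OF g] unfolding splitting_closure_def by auto
  fix h assume h: "galois C D deg h \<and> f \<sqsubseteq> h \<and> h \<sqsubseteq> g"
  then obtain Z where Z: "cov h Z A"
    using cover_iff_cov[of h] cov_Cod[OF g] unfolding galois_def below_def by auto
  obtain k where k: "cov k Z B" "h = f \<odot> k"
    using below_iff[OF f Z] h by blast
  have "splits h f"
    using splits_cmp[OF k(1) f] galois_iff_splits[OF Z] h k(2) by blast
  then show "g \<sqsubseteq> h"
    using cl cov_cover[OF Z] cov_Cod[OF Z] cov_Cod[OF f] unfolding splitting_closure_def by simp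
qed

lemma splitting_closure_small:
  assumes f: "cov f B A" and deg: "deg f \<le> 2"
  shows "splitting_closure f f"
proof -
  have "f \<sqsubseteq> h" if h: "cover C D h" "Cod C h = Cod C f" "splits h f" for h
  proof -
    obtain Z where Z: "cov h Z A"
      using h cover_iff_cov[of h] cov_Cod[OF f] by auto
    show ?thesis
      using splits_ex_factor[OF h(3) Z f] below_iff[OF f Z] by blast
  qed
  moreover have "f \<sqsubseteq> f"
    using below_iff[OF f f] cov_Id[OF cov_Dom_in[OF f]] cov_Cmp_Id[OF f] by auto
  ultimately show ?thesis
    unfolding splitting_closure_def using splits_self_small[OF f deg] by blast
qed

lemma below_trans:
  assumes "cov f X A" "cov g Y A" "cov h Z A" "f \<sqsubseteq> g" "g \<sqsubseteq> h"
  shows "f \<sqsubseteq> h"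
proof -
  obtain a where a: "cov a Y X" "g = f \<odot> a"
    using below_iff[OF assms(1,2)] assms(4) by blast
  obtain b where b: "cov b Z Y" "h = g \<odot> b"
    using below_iff[OF assms(2,3)] assms(5) by blast
  have "h = f \<odot> (a \<odot> b)"
    using a(2) b(2) cov_assoc[OF b(1) a(1) assms(1)] by simp
  then show ?thesis
    using below_iff[OF assms(1,3)] cov_cmp[OF b(1) a(1)] by blast
qed

section \<open>Joins of covers and components of pullbacks\<close>

lemma join_cov:
  assumes pb: "pullback g h V r s" and g: "cov g X B" and h: "cov h Y B" and i: "i \<in> Sig V"
  obtains W where "arrow i W V" "cov (r \<odot> i) W X" "cov (s \<odot> i) W Y" "cov (g \<odot> (r \<odot> i)) W B"
    "g \<odot> (r \<odot> i) = h \<odot> (s \<odot> i)"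
proof -
  note ar = pullback_arrows[OF pb g h]
  have XY: "X \<in> D" "Y \<in> D"
    using g h by (auto simp: cov_def)
  obtain W where W: "arrow i W V" "cov (r \<odot> i) W X"
    using cov_component[OF ar(1) XY(1) i] .
  have si: "cov (s \<odot> i) W Y"
    using arrow_cmp[OF W(1) ar(2)] XY W(2) by (auto simp: cov_def)
  have "g \<odot> (r \<odot> i) = h \<odot> (s \<odot> i)"
    using arrow_assoc[OF W(1) ar(1) cov_arrow[OF g]] arrow_assoc[OF W(1) ar(2) cov_arrow[OF h]] ar(3)
    by simp
  then show thesis
    using that W si cov_cmp[OF W(2) g] by blast
qed

lemma monic_cancel:
  assumes "monic C i" "arrow i W U" "cov x X W" "cov y X W" "i \<odot> x = i \<odot> y"
  shows "x = y"
proof -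
  have "\<forall>x\<in>Arr C. \<forall>y\<in>Arr C. Dom C x = Dom C y \<and> Cod C x = Dom C i \<and> Cod C y = Dom C i \<and>
      i \<odot> x = i \<odot> y \<longrightarrow> x = y"
    using assms(1) unfolding monic_def by (elim conjE) assumption
  from bspec[OF bspec[OF this, of x], of y] show ?thesis
    using assms(2-) by (simp add: cov_def arrow_def)
qed

text \<open>Endomorphisms \<open>\<sigma>\<close> of \<open>g\<close> and \<open>\<tau>\<close> of
  \<open>h\<close> correct \<open>a\<close> and \<open>b\<close> so that they match the projections
  of \<open>y\<close> after \<open>x\<close>. The corrected pair defines \<open>u\<close> into the
  pullback with \<open>u \<odot> x = i \<odot> y\<close>, so \<open>u\<close> runs through
  \<open>i\<close>, and monicity of \<open>i\<close> identifies its factor. Taking the join itself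
  for \<open>G'\<close> makes the join self-splitting; an arbitrary upper bound \<open>G'\<close>
  gives its minimality.\<close>

lemma splits_join:
  assumes pb: "pullback g h V r s" and g: "cov g X B" and h: "cov h Y B" and i: "i \<in> Sig V"
    and mono: "monic C i" and gg: "splits g g" and hh: "splits h h"
    and G': "cov G' Z B" "g \<sqsubseteq> G'" "h \<sqsubseteq> G'"
  shows "splits G' (g \<odot> (r \<odot> i))"
proof -
  note ar = pullback_arrows[OF pb g h]
  obtain W where W: "arrow i W V" "cov (r \<odot> i) W X" "cov (s \<odot> i) W Y" "cov (g \<odot> (r \<odot> i)) W B"
    "g \<odot> (r \<odot> i) = h \<odot> (s \<odot> i)"
    using join_cov[OF pb g h i] .
  obtain a where a: "cov a Z X" "G' = g \<odot> a"
    using below_iff[OF g G'(1)] G'(2) by blast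
  obtain b where b: "cov b Z Y" "G' = h \<odot> b"
    using below_iff[OF h G'(1)] G'(3) by blast
  show ?thesis
  proof (rule splitsI[OF G'(1) W(4)])
    fix x y T
    assume xy: "cov x T Z" "cov y T W" "G' \<odot> x = (g \<odot> (r \<odot> i)) \<odot> y"
    have eg: "g \<odot> (a \<odot> x) = g \<odot> ((r \<odot> i) \<odot> y)"
      using xy a(2) cov_assoc[OF xy(1) a(1) g] cov_assoc[OF xy(2) W(2) g] by simp
    have eh: "h \<odot> (b \<odot> x) = h \<odot> ((s \<odot> i) \<odot> y)"
      using xy b(2) W(5) cov_assoc[OF xy(1) b(1) h] cov_assoc[OF xy(2) W(3) h] by simp
    obtain \<sigma> where \<sigma>: "cov \<sigma> X X" "g \<odot> \<sigma> = g" "\<sigma> \<odot> (a \<odot> x) = (r \<odot> i) \<odot> y"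
      using splitsE[OF gg g g cov_cmp[OF xy(1) a(1)] cov_cmp[OF xy(2) W(2)] eg] .
    obtain \<tau> where \<tau>: "cov \<tau> Y Y" "h \<odot> \<tau> = h" "\<tau> \<odot> (b \<odot> x) = (s \<odot> i) \<odot> y"
      using splitsE[OF hh h h cov_cmp[OF xy(1) b(1)] cov_cmp[OF xy(2) W(3)] eh] .
    have "g \<odot> (\<sigma> \<odot> a) = h \<odot> (\<tau> \<odot> b)"
      using cov_assoc[OF a(1) \<sigma>(1) g] cov_assoc[OF b(1) \<tau>(1) h] \<sigma> \<tau> a b by simp
    then obtain u where u: "arrow u Z V" "r \<odot> u = \<sigma> \<odot> a" "s \<odot> u = \<tau> \<odot> b"
      using pullback_factor[OF pb g h cov_cmp[OF a(1) \<sigma>(1)] cov_cmp[OF b(1) \<tau>(1)]] by blast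
    have iy: "arrow (i \<odot> y) T V"
      using arrow_cmp[OF cov_arrow[OF xy(2)] W(1)] .
    have iyu: "i \<odot> y = u \<odot> x"
    proof (rule pullback_unique[OF pb g h iy arrow_cmp[OF cov_arrow[OF xy(1)] u(1)]])
      show "r \<odot> (i \<odot> y) = r \<odot> (u \<odot> x)"
        using arrow_assoc[OF cov_arrow[OF xy(2)] W(1) ar(1)] u(2) \<sigma>(3)
          arrow_assoc[OF cov_arrow[OF xy(1)] u(1) ar(1)] cov_assoc[OF xy(1) a(1) \<sigma>(1)] by simp
      show "s \<odot> (i \<odot> y) = s \<odot> (u \<odot> x)"
        using arrow_assoc[OF cov_arrow[OF xy(2)] W(1) ar(2)] u(3) \<tau>(3)
          arrow_assoc[OF cov_arrow[OF xy(1)] u(1) ar(2)] cov_assoc[OF xy(1) b(1) \<tau>(1)] by simp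
    qed
    then obtain w where w: "cov w Z W" "u = i \<odot> w"
      using factor_same_component[OF i W(1) xy(2) u(1) xy(1)] by blast
    have "i \<odot> y = i \<odot> (w \<odot> x)"
      using iyu w(2) arrow_assoc[OF cov_arrow[OF xy(1)] cov_arrow[OF w(1)] W(1)] by simp
    then have "w \<odot> x = y"
      using monic_cancel[OF mono W(1) cov_cmp[OF xy(1) w(1)] xy(2)] by simp
    then show "\<exists>h. cov h Z W \<and> h \<odot> x = y"
      using w(1) by blast
  qed
qed

text \<open>Since \<open>f \<odot> e\<close> splits \<open>f\<close>, there is a second lift
  \<open>e'\<close> of \<open>f \<odot> e\<close> that matches
  \<open>(q \<odot> i) \<odot> y\<close> after \<open>x\<close>. The pair \<open>e, e'\<close>
  defines an arrow into the pullback which runs through \<open>i\<close>, and monicity of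
  \<open>i\<close> finishes as for joins.\<close>

lemma splits_component:
  assumes pb: "pullback f f U p q" and f: "cov f B A" and i: "i \<in> Sig U" and mono: "monic C i"
    and e: "cov e Y B" and sp: "splits (f \<odot> e) f"
  shows "splits e (p \<odot> i)"
proof -
  note ar = pullback_arrows[OF pb f f]
  obtain W where W: "arrow i W U" "cov (p \<odot> i) W B" "cov (q \<odot> i) W B"
      "f \<odot> (p \<odot> i) = f \<odot> (q \<odot> i)"
    using join_cov[OF pb f f i] by blast
  show ?thesis
  proof (rule splitsI[OF e W(2)])
    fix x y T
    assume xy: "cov x T Y" "cov y T W" "e \<odot> x = (p \<odot> i) \<odot> y"
    have "(f \<odot> e) \<odot> x = f \<odot> ((q \<odot> i) \<odot> y)"
      using cov_assoc[OF xy(1) e f] cov_assoc[OF xy(2) W(2) f] cov_assoc[OF xy(2) W(3) f] xy(3) W(4)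
      by simp
    then obtain e' where e': "cov e' Y B" "f \<odot> e' = f \<odot> e" "e' \<odot> x = (q \<odot> i) \<odot> y"
      using splitsE[OF sp cov_cmp[OF e f] f xy(1) cov_cmp[OF xy(2) W(3)]] by blast
    obtain u where u: "arrow u Y U" "p \<odot> u = e" "q \<odot> u = e'"
      using pullback_factor[OF pb f f e e'(1) e'(2)[symmetric]] .
    have iy: "arrow (i \<odot> y) T U"
      using arrow_cmp[OF cov_arrow[OF xy(2)] W(1)] .
    have iyu: "i \<odot> y = u \<odot> x"
    proof (rule pullback_unique[OF pb f f iy arrow_cmp[OF cov_arrow[OF xy(1)] u(1)]])
      show "p \<odot> (i \<odot> y) = p \<odot> (u \<odot> x)"
        using arrow_assoc[OF cov_arrow[OF xy(2)] W(1) ar(1)] u(2) xy(3)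
          arrow_assoc[OF cov_arrow[OF xy(1)] u(1) ar(1)] by simp
      show "q \<odot> (i \<odot> y) = q \<odot> (u \<odot> x)"
        using arrow_assoc[OF cov_arrow[OF xy(2)] W(1) ar(2)] u(3) e'(3)
          arrow_assoc[OF cov_arrow[OF xy(1)] u(1) ar(2)] by simp
    qed
    then obtain w where w: "cov w Y W" "u = i \<odot> w"
      using factor_same_component[OF i W(1) xy(2) u(1) xy(1)] by blast
    have "i \<odot> y = i \<odot> (w \<odot> x)"
      using iyu w(2) arrow_assoc[OF cov_arrow[OF xy(1)] cov_arrow[OF w(1)] W(1)] by simp
    then have "w \<odot> x = y"
      using monic_cancel[OF mono W(1) cov_cmp[OF xy(1) w(1)] xy(2)] by simp
    then show "\<exists>h. cov h Y W \<and> h \<odot> x = y"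
      using w(1) by blast
  qed
qed

text \<open>Correctness of the composite in step (5). It splits \<open>f\<close> because the pair
  \<open>g \<odot> x, y\<close> lands in some component \<open>i\<close>, and \<open>g\<close>,
  being self-splitting and above \<open>p \<odot> i\<close>, splits it. Self-splitting and the
  universal property both rest on \<open>factor\<close>.\<close>

lemma splitting_closure_cmp:
  assumes pb: "pullback f f U p q" and f: "cov f B A" and mono: "\<And>i. i \<in> Sig U \<Longrightarrow> monic C i"
    and g: "cov g Y B" and gg: "splits g g" and above: "\<And>i. i \<in> Sig U \<Longrightarrow> p \<odot> i \<sqsubseteq> g"
    and univ: "\<And>h. cover C D h \<Longrightarrow> Cod C h = B \<Longrightarrow> (\<And>i. i \<in> Sig U \<Longrightarrow> splits h (p \<odot> i)) \<Longrightarrow> g \<sqsubseteq> h"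
  shows "splitting_closure f (f \<odot> g)"
proof -
  note ar = pullback_arrows[OF pb f f]
  note fg = cov_cmp[OF g f]
  have factor: "\<exists>w. cov w Z Y \<and> e = g \<odot> w" if "cov e Z B" "splits (f \<odot> e) f" for e Z
    using univ[of e] splits_component[OF pb f _ mono that] below_iff[OF g that(1)]
      cov_cover[OF that(1)] cov_Cod[OF that(1)] by blast
  have spf: "splits (f \<odot> g) f"
  proof (rule splitsI[OF fg f])
    fix x y X
    assume xy: "cov x X Y" "cov y X B" "(f \<odot> g) \<odot> x = f \<odot> y"
    have "f \<odot> (g \<odot> x) = f \<odot> y"
      using xy cov_assoc[OF xy(1) g f] by simp
    then obtain u where u: "arrow u X U" "p \<odot> u = g \<odot> x" "q \<odot> u = y"
      using pullback_factor[OF pb f f cov_cmp[OF xy(1) g] xy(2)] by blast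
    obtain i z where i: "i \<in> Sig U" "cov z X (Dom C i)" "u = i \<odot> z"
      using factor_Sig[OF u(1)] xy(1) cov_Dom_in by blast
    obtain W where W: "arrow i W U" "cov (p \<odot> i) W B" "cov (q \<odot> i) W B"
      using join_cov[OF pb f f i(1)] by blast
    have z: "cov z X W"
      using i W by (auto simp: arrow_def)
    obtain m where m: "cov m Y W" "g = (p \<odot> i) \<odot> m"
      using below_iff[OF W(2) g] above[OF i(1)] by blast
    have "splits g (p \<odot> i)"
      using splits_cmp[OF m(1) W(2)] gg m(2) by simp
    moreover have "g \<odot> x = (p \<odot> i) \<odot> z"
      using u(2) i(3) arrow_assoc[OF cov_arrow[OF z] W(1) ar(1)] by simp
    ultimately obtain h where h: "cov h Y W" "h \<odot> x = z"
      using splitsE[OF _ g W(2) xy(1) z] by blast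
    have "((q \<odot> i) \<odot> h) \<odot> x = y"
      using cov_assoc[OF xy(1) h(1) W(3)] h(2) u(3) i(3)
        arrow_assoc[OF cov_arrow[OF z] W(1) ar(2)] by simp
    then show "\<exists>h. cov h Y B \<and> h \<odot> x = y"
      using cov_cmp[OF h(1) W(3)] by blast
  qed
  have "splits (f \<odot> g) (f \<odot> g)"
  proof (rule splitsI[OF fg fg])
    fix x y X
    assume xy: "cov x X Y" "cov y X Y" "(f \<odot> g) \<odot> x = (f \<odot> g) \<odot> y"
    have "(f \<odot> g) \<odot> x = f \<odot> (g \<odot> y)"
      using xy cov_assoc[OF xy(2) g f] by simp
    \<comment> \<open>The lift \<open>e\<close> may differ from \<open>g\<close>, but
      \<open>f \<odot> e = f \<odot> g\<close> still splits \<open>f\<close>. Minimality of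
      \<open>g\<close> thus makes \<open>e\<close> factor through \<open>g\<close>, and
      self-splitting of \<open>g\<close> corrects the remaining discrepancy.\<close>
    then obtain e where e: "cov e Y B" "f \<odot> e = f \<odot> g" "e \<odot> x = g \<odot> y"
      using splitsE[OF spf fg f xy(1) cov_cmp[OF xy(2) g]] by blast
    obtain w where w: "cov w Y Y" "e = g \<odot> w"
      using factor[OF e(1)] e(2) spf by auto
    have "g \<odot> (w \<odot> x) = g \<odot> y"
      using e(3) w(2) cov_assoc[OF xy(1) w(1) g] by simp
    then obtain \<sigma> where \<sigma>: "cov \<sigma> Y Y" "\<sigma> \<odot> (w \<odot> x) = y"
      using splitsE[OF gg g g cov_cmp[OF xy(1) w(1)] xy(2)] by blast
    then show "\<exists>h. cov h Y Y \<and> h \<odot> x = y"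
      using cov_assoc[OF xy(1) w(1) \<sigma>(1)] cov_cmp[OF w(1) \<sigma>(1)] by auto
  qed
  moreover have "f \<sqsubseteq> f \<odot> g"
    using below_iff[OF f fg] g by blast
  moreover have "f \<odot> g \<sqsubseteq> h" if h: "cover C D h" "Cod C h = Cod C f" "splits h f" for h
  proof -
    obtain Z where Z: "cov h Z A"
      using h cover_iff_cov[of h] cov_Cod[OF f] by auto
    obtain e where e: "cov e Z B" "f \<odot> e = h"
      using splits_ex_factor[OF h(3) Z f] .
    obtain w where w: "cov w Z Y" "e = g \<odot> w"
      using factor[OF e(1)] e(2) h(3) by auto
    then have "h = (f \<odot> g) \<odot> w"
      using e(2) cov_assoc[OF w(1) g f] by simp
    then show ?thesis
      using below_iff[OF fg Z] w(1) by blast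
  qed
  ultimately show ?thesis
    unfolding splitting_closure_def by blast
qed

end

section \<open>Runs of the algorithm\<close>

text \<open>\<open>inevitable r F x\<close>: every maximal run of \<open>r\<close> from \<open>x\<close> is finite and reaches \<open>F\<close>. Stating
  the correctness of a call relative to an arbitrary stack whose continuation is inevitable
  makes the recursion of the algorithm an induction on the degree.\<close>

inductive inevitable :: "('s \<Rightarrow> 's \<Rightarrow> bool) \<Rightarrow> ('s \<Rightarrow> bool) \<Rightarrow> 's \<Rightarrow> bool" for r F where
  final: "F x \<Longrightarrow> inevitable r F x"
| step: "r x y \<Longrightarrow> (\<And>z. r x z \<Longrightarrow> inevitable r F z) \<Longrightarrow> inevitable r F x"

lemma inevitable_no_infinite_run:
  assumes "inevitable r F x" and final: "\<forall>y z. F y \<longrightarrow> \<not> r y z"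
  shows "\<not> (\<exists>s. s 0 = x \<and> (\<forall>n::nat. r (s n) (s (Suc n))))"
  using assms(1)
proof induction
  case (final x)
  then show ?case using assms(2) by metis
next
  case (step x y)
  show ?case
  proof
    assume "\<exists>s. s 0 = x \<and> (\<forall>n::nat. r (s n) (s (Suc n)))"
    then obtain s where s: "s 0 = x" "\<And>n::nat. r (s n) (s (Suc n))"
      by blast
    have "r x (s 1)"
      using s(1) s(2)[of 0] by simp
    moreover have "\<exists>t. t 0 = s 1 \<and> (\<forall>n::nat. r (t n) (t (Suc n)))"
      using s(2) by (intro exI[of _ "\<lambda>n. s (Suc n)"]) simp
    ultimately show False
      using step.IH by blast
  qed
qed

lemma inevitable_stuck:
  assumes "r\<^sup>*\<^sup>* x y" and "inevitable r F x" and final: "\<forall>y z. F y \<longrightarrow> \<not> r y z"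
    and "\<not> (\<exists>z. r y z)"
  shows "F y"
proof -
  have "inevitable r F y"
    using assms(1,2)
  proof (induction rule: rtranclp_induct)
    case (step y z)
    from step.IH[OF step.prems] step.hyps(2) show ?case
      using final by (auto elim: inevitable.cases)
  qed
  then show ?thesis
    using assms(4) by (auto elim: inevitable.cases)
qed

section \<open>Invariants of the timed runs\<close>

locale timed_galois_setting = galois_setting C D Sig deg
  for C :: "('o, 'a) cat" (structure) and D :: "'o set" and Sig :: "'o \<Rightarrow> 'a set"
    and deg :: "'a \<Rightarrow> nat" +
  fixes pb_time :: "'a \<Rightarrow> 'a \<Rightarrow> enat" and Sig_time :: "'o \<Rightarrow> enat" and deg_time :: "'a \<Rightarrow> enat"
  assumes pb_time: "\<lbrakk>cover C D f; cover C D g; Cod C f = Cod C g\<rbrakk> \<Longrightarrow> pb_time f g < \<infinity>"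
    and Sig_time: "U \<in> Obj C \<Longrightarrow> Sig_time U < \<infinity>"
    and deg_time: "cover C D f \<Longrightarrow> deg_time f < \<infinity>"
begin

abbreviation rstep :: "'a state \<Rightarrow> 'a state \<Rightarrow> bool" where
  "rstep \<equiv> R_step C Sig deg pb_time Sig_time deg_time"

text \<open>While the waiting time is positive only \<open>tick\<close> applies, as every other rule
  demands time 0; a finite time therefore runs down to 0.\<close>

lemma inevitable_tick:
  assumes "inevitable rstep F (0, c, st)" and "t < \<infinity>"
  shows "inevitable rstep F (t, c, st)"
proof -
  have "inevitable rstep F (enat n, c, st)" for n
  proof (induction n)
    case 0
    then show ?case using assms(1) by (simp add: zero_enat_def)
  next
    case (Suc n)
    have eq: "enat (Suc n) = eSuc (enat n)"
      by (simp add: eSuc_enat)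
    show ?case
    proof (rule inevitable.step)
      show "rstep (enat (Suc n), c, st) (enat n, c, st)"
        unfolding eq by (rule R_step.tick)
      fix z assume "rstep (enat (Suc n), c, st) z"
      then show "inevitable rstep F z"
        unfolding eq using Suc by (cases rule: R_step.cases) simp_all
    qed
  qed
  then show ?thesis
    using assms(2) by (cases t) auto
qed

text \<open>Condition (G5). It stays a premise inside the invariants, so that a single induction
  over runs yields termination without it and correctness under it.\<close>

definition monic_components :: bool where
  "monic_components \<longleftrightarrow> (\<forall>U\<in>Obj C. \<forall>i\<in>Sig U. monic C i)"

lemma monic_component: "monic_components \<Longrightarrow> arrow p U B \<Longrightarrow> i \<in> Sig U \<Longrightarrow> monic C i"
  unfolding monic_components_def using Dom_Obj by (auto simp: arrow_def)

text \<open>The contract of a call on \<open>f\<close>: the typing part keeps the run going, the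
  closure part carries correctness.\<close>

definition post :: "'a \<Rightarrow> 'a \<Rightarrow> bool" where
  "post f g \<longleftrightarrow> (\<exists>Y. cov g Y (Cod C f)) \<and> (monic_components \<longrightarrow> splitting_closure f g)"

text \<open>The invariant of single members of \<open>S\<close>. That the components
  \<open>p \<odot> i\<close> are dominated is not demanded here, since it is a property of
  \<open>S\<close> as a whole.\<close>

definition candidate :: "'a \<Rightarrow> 'o \<Rightarrow> 'o \<Rightarrow> 'a \<Rightarrow> bool" where
  "candidate p U B s \<longleftrightarrow> (\<exists>Y. cov s Y B) \<and> (monic_components \<longrightarrow> splits s s \<and>
    (\<forall>h. cover C D h \<and> Cod C h = B \<and> (\<forall>i\<in>Sig U. splits h (p \<odot> i)) \<longrightarrow> s \<sqsubseteq> h))"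

lemma candidate_join:
  assumes pb: "pullback g h V r s" and g: "candidate p U B g" and h: "candidate p U B h"
    and i: "i \<in> Sig V"
  shows "candidate p U B (g \<odot> (r \<odot> i))"
    and "monic_components \<Longrightarrow> g \<sqsubseteq> g \<odot> (r \<odot> i) \<and> h \<sqsubseteq> g \<odot> (r \<odot> i)"
proof -
  obtain X where X: "cov g X B"
    using g unfolding candidate_def by blast
  obtain Y where Y: "cov h Y B"
    using h unfolding candidate_def by blast
  obtain W where W: "arrow i W V" "cov (r \<odot> i) W X" "cov (s \<odot> i) W Y" "cov (g \<odot> (r \<odot> i)) W B"
    "g \<odot> (r \<odot> i) = h \<odot> (s \<odot> i)"
    using join_cov[OF pb X Y i] .
  have above: "g \<sqsubseteq> g \<odot> (r \<odot> i)" "h \<sqsubseteq> g \<odot> (r \<odot> i)"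
    using below_iff[OF X W(4)] below_iff[OF Y W(4)] W(2,3,5) by auto
  then show "monic_components \<Longrightarrow> g \<sqsubseteq> g \<odot> (r \<odot> i) \<and> h \<sqsubseteq> g \<odot> (r \<odot> i)"
    by blast
  show "candidate p U B (g \<odot> (r \<odot> i))"
    unfolding candidate_def
  proof (intro conjI impI allI)
    show "\<exists>Y. cov (g \<odot> (r \<odot> i)) Y B"
      using W(4) by blast
    assume mono: monic_components
    note gh = g[unfolded candidate_def, THEN conjunct2, THEN mp, OF mono]
      h[unfolded candidate_def, THEN conjunct2, THEN mp, OF mono]
    note mi = monic_component[OF mono pullback_arrows(1)[OF pb X Y] i]
    note join = splits_join[OF pb X Y i mi gh(1)[THEN conjunct1] gh(2)[THEN conjunct1]]
    \<comment> \<open>The upper bound in \<open>splits_join\<close> is the join itself.\<close>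
    show "splits (g \<odot> (r \<odot> i)) (g \<odot> (r \<odot> i))"
      using join[OF W(4) above] .
    fix k assume k: "cover C D k \<and> Cod C k = B \<and> (\<forall>i\<in>Sig U. splits k (p \<odot> i))"
    then obtain Z where Z: "cov k Z B"
      using cover_iff_cov[of k] by auto
    \<comment> \<open>Now \<open>k\<close> is the upper bound: it splits the join and hence lies
      above it.\<close>
    have "g \<sqsubseteq> k" "h \<sqsubseteq> k"
      using gh k by blast+
    then show "g \<odot> (r \<odot> i) \<sqsubseteq> k"
      using splits_ex_factor[OF join[OF Z] Z W(4)] below_iff[OF W(4) Z] by blast
  qed
qed

text \<open>Induction on \<open>card S\<close>. The loop keeps \<open>S\<close> a finite nonempty
  set of candidates such that, under (G5), every \<open>p \<odot> i\<close> lies below a member; at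
  a singleton this is what \<open>splitting_closure_cmp\<close> asks for.\<close>

lemma inevitable_loop:
  assumes pb: "pullback f f U p q" and f: "cov f B A"
    and cont: "\<And>g. post f g \<Longrightarrow> inevitable rstep F (0, Return g, st)"
    and "finite S" "S \<noteq> {}" and "\<forall>s\<in>S. candidate p U B s"
    and "monic_components \<longrightarrow> (\<forall>i\<in>Sig U. \<exists>s\<in>S. p \<odot> i \<sqsubseteq> s)"
  shows "inevitable rstep F (0, Loop f S, st)"
  using assms(4-)
proof (induction "card S" arbitrary: S rule: less_induct)
  case (less S)
  note fin = \<open>finite S\<close> and cand = \<open>\<forall>s\<in>S. candidate p U B s\<close>
  note ar = pullback_arrows[OF pb f f]
  have B: "B \<in> D"
    using cov_Dom_in[OF f] .
  have exit: "inevitable rstep F (0, Return (f \<odot> g), st)" if S: "S = {g}" for g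
  proof -
    obtain Y where Y: "cov g Y B"
      using cand S unfolding candidate_def by blast
    have "splitting_closure f (f \<odot> g)" if mono: monic_components
    proof (rule splitting_closure_cmp[OF pb f _ Y])
      show "monic C i" if "i \<in> Sig U" for i
        using monic_component[OF mono ar(1) that] .
      show "p \<odot> i \<sqsubseteq> g" if "i \<in> Sig U" for i
        using less.prems(4) mono that S by blast
      show "splits g g"
        using cand S mono unfolding candidate_def by simp
      fix h
      assume "cover C D h" "Cod C h = B" "\<And>i. i \<in> Sig U \<Longrightarrow> splits h (p \<odot> i)"
      then show "g \<sqsubseteq> h"
        using cand S mono unfolding candidate_def by simp
    qed
    then show ?thesis
      using cont[of "f \<odot> g"] cov_cmp[OF Y f] cov_Cod[OF f] unfolding post_def by blast
  qed
  have pick: "inevitable rstep F (pb_time g h, Loop_Pullback f S g h, st)"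
    if gh: "g \<in> S" "h \<in> S" "g \<noteq> h" for g h
  proof -
    obtain X where X: "cov g X B"
      using cand gh unfolding candidate_def by blast
    obtain Y where Y: "cov h Y B"
      using cand gh unfolding candidate_def by blast
    have time: "pb_time g h < \<infinity>"
      using pb_time[OF cov_cover[OF X] cov_cover[OF Y]] cov_Cod[OF X] cov_Cod[OF Y] by simp
    have component: "inevitable rstep F (Sig_time (Dom C r), Loop_Component f S g h r, st)"
      if rs: "is_pullback C g h r s" for r s
    proof (rule inevitable_tick)
      have V: "pullback g h (Dom C r) r s"
        using rs unfolding pullback_def by simp
      note ar' = pullback_arrows[OF V X Y]
      show "Sig_time (Dom C r) < \<infinity>"
        using Sig_time Dom_Obj ar'(1) by (auto simp: arrow_def)
      obtain j where j: "j \<in> Sig (Dom C r)"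
        using Sig_nonempty[OF ar'(1) cov_Dom_in[OF X]] by blast
      have IH: "inevitable rstep F (0, Loop f ((S - {g, h}) \<union> {g \<odot> r \<odot> i}), st)"
        if i: "i \<in> Sig (Dom C r)" for i
      proof (rule less.hyps)
        \<comment> \<open>The new cover may already be in \<open>S - {g, h}\<close>, so the size
          drops by one or by two.\<close>
        have "card ((S - {g, h}) \<union> {g \<odot> r \<odot> i}) \<le> card (S - {g, h}) + 1"
          using card_Un_le[of "S - {g, h}" "{g \<odot> r \<odot> i}"] by simp
        moreover have "card (S - {g, h}) + 2 = card S"
          using gh fin card_Diff_subset[of "{g, h}" S] card_mono[OF fin, of "{g, h}"] by simp
        ultimately show "card ((S - {g, h}) \<union> {g \<odot> r \<odot> i}) < card S"
          by simp
        show "finite ((S - {g, h}) \<union> {g \<odot> r \<odot> i})" "(S - {g, h}) \<union> {g \<odot> r \<odot> i} \<noteq> {}"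
          using fin by simp_all
        have cg: "candidate p U B g" and ch: "candidate p U B h"
          using cand gh by blast+
        note join = candidate_join[OF V cg ch i]
        show "\<forall>s\<in>S - {g, h} \<union> {g \<odot> r \<odot> i}. candidate p U B s"
          using cand join(1) by blast
        show "monic_components \<longrightarrow> (\<forall>k\<in>Sig U. \<exists>s\<in>S - {g, h} \<union> {g \<odot> r \<odot> i}. p \<odot> k \<sqsubseteq> s)"
        proof (intro impI ballI)
          fix k assume mono: monic_components and k: "k \<in> Sig U"
          obtain s where s: "s \<in> S" "p \<odot> k \<sqsubseteq> s"
            using less.prems(4) mono k by blast
          obtain K where K: "cov (p \<odot> k) K B"
            using cov_component[OF ar(1) B k] by blast
          obtain L where L: "cov s L B"
            using cand s(1) unfolding candidate_def by blast
          obtain W where W: "cov (g \<odot> r \<odot> i) W B"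
            using join(1) unfolding candidate_def by blast
          \<comment> \<open>A component dominated by a removed cover is dominated by the
            join.\<close>
          have "p \<odot> k \<sqsubseteq> g \<odot> r \<odot> i" if "s = g \<or> s = h"
            using below_trans[OF K L W s(2)] join(2)[OF mono] that by blast
          then show "\<exists>s\<in>S - {g, h} \<union> {g \<odot> r \<odot> i}. p \<odot> k \<sqsubseteq> s"
            using s by blast
        qed
      qed
      show "inevitable rstep F (0, Loop_Component f S g h r, st)"
      proof (rule inevitable.step)
        show "rstep (0, Loop_Component f S g h r, st) (0, Loop f ((S - {g, h}) \<union> {g \<odot> r \<odot> j}), st)"
          using j by (rule R_step.loop_component)
        fix z assume "rstep (0, Loop_Component f S g h r, st) z"
        then show "inevitable rstep F z"
          by cases (use IH in simp_all)
      qed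
    qed
    obtain r s where rs: "is_pullback C g h r s"
      using pullback_ex[OF X Y] unfolding pullback_def by blast
    have "inevitable rstep F (0, Loop_Pullback f S g h, st)"
    proof (rule inevitable.step)
      show "rstep (0, Loop_Pullback f S g h, st) (Sig_time (Dom C r), Loop_Component f S g h r, st)"
        using rs by (rule R_step.loop_pullback)
      fix z assume "rstep (0, Loop_Pullback f S g h, st) z"
      then show "inevitable rstep F z"
        by cases (use component in simp_all)
    qed
    then show ?thesis
      using time by (rule inevitable_tick)
  qed
  have progress: "\<exists>z. rstep (0, Loop f S, st) z"
  proof (cases "\<exists>g h. g \<in> S \<and> h \<in> S \<and> g \<noteq> h")
    case True
    then show ?thesis
      using R_step.loop_pick by metis
  next
    case False
    then obtain g where "S = {g}"
      using \<open>S \<noteq> {}\<close> by blast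
    then show ?thesis
      using R_step.loop_exit by metis
  qed
  have next_state: "inevitable rstep F z" if "rstep (0, Loop f S, st) z" for z
    using that by cases (use exit pick in simp_all)
  show ?case
    using progress next_state inevitable.step by metis
qed

text \<open>Induction on the number of pending components \<open>I\<close>; those outside
  \<open>I\<close> are already dominated by \<open>S\<close> under (G5). The disjunction
  \<open>I \<noteq> {} \<or> S \<noteq> {}\<close> ensures that the loop is entered with a nonempty
  \<open>S\<close>.\<close>

lemma inevitable_collect:
  assumes pb: "pullback f f U p q" and f: "cov f B A"
    and cont: "\<And>g. post f g \<Longrightarrow> inevitable rstep F (0, Return g, st)"
    and call: "\<And>i st'. i \<in> Sig U \<Longrightarrow> (\<And>g. post (p \<odot> i) g \<Longrightarrow> inevitable rstep F (0, Return g, st'))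
      \<Longrightarrow> inevitable rstep F (0, Call (p \<odot> i), st')"
    and "I \<subseteq> Sig U" and "finite S" and "I \<noteq> {} \<or> S \<noteq> {}" and "\<forall>s\<in>S. candidate p U B s"
    and "monic_components \<longrightarrow> (\<forall>i\<in>Sig U - I. \<exists>s\<in>S. p \<odot> i \<sqsubseteq> s)"
  shows "inevitable rstep F (0, Collect f p I S, st)"
  using assms(5-)
proof (induction "card I" arbitrary: I S rule: less_induct)
  case (less I S)
  note ar = pullback_arrows[OF pb f f]
  have B: "B \<in> D"
    using cov_Dom_in[OF f] .
  have fin: "finite I"
    using finite_Sig[OF ar(1) B] less.prems(1) finite_subset by blast
  have collected: "inevitable rstep F (0, Loop f S, st)" if "I = {}"
    using inevitable_loop[OF pb f cont] less.prems that by simp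
  have rec_call: "inevitable rstep F (deg_time (p \<odot> i), Call (p \<odot> i), (f, p, I - {i}, S) # st)"
    if i: "i \<in> I" for i
  proof (rule inevitable_tick)
    have iS: "i \<in> Sig U"
      using i less.prems(1) by blast
    obtain W where W: "cov (p \<odot> i) W B"
      using cov_component[OF ar(1) B iS] .
    show "deg_time (p \<odot> i) < \<infinity>"
      using deg_time cov_cover[OF W] .
    show "inevitable rstep F (0, Call (p \<odot> i), (f, p, I - {i}, S) # st)"
    proof (rule call[OF iS])
      fix g assume g: "post (p \<odot> i) g"
      \<comment> \<open>A cover that splits all components splits this one, hence lies above its
        splitting closure \<open>g\<close>.\<close>
      have "candidate p U B g"
        using g iS cov_Cod[OF W] unfolding post_def candidate_def splitting_closure_def by auto
      moreover have "p \<odot> i \<sqsubseteq> g" if monic_components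
        using g that unfolding post_def splitting_closure_def by blast
      moreover have "card (I - {i}) < card I"
        using i fin by (rule card_Diff1_less[rotated])
      ultimately have IH: "inevitable rstep F (0, Collect f p (I - {i}) (insert g S), st)"
        using less.prems by (intro less.hyps) auto
      show "inevitable rstep F (0, Return g, (f, p, I - {i}, S) # st)"
      proof (rule inevitable.step)
        show "rstep (0, Return g, (f, p, I - {i}, S) # st) (0, Collect f p (I - {i}) (insert g S), st)"
          by (rule R_step.rec_return)
        fix z assume "rstep (0, Return g, (f, p, I - {i}, S) # st) z"
        then show "inevitable rstep F z"
          by cases (use IH in simp_all)
      qed
    qed
  qed
  have progress: "\<exists>z. rstep (0, Collect f p I S, st) z"
  proof (cases "I = {}")
    case True
    then show ?thesis
      using R_step.collected by metis
  next
    case False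
    then obtain i where "i \<in> I"
      by blast
    then show ?thesis
      using R_step.rec_call by metis
  qed
  have next_state: "inevitable rstep F z" if "rstep (0, Collect f p I S, st) z" for z
    using that by cases (use rec_call collected in simp_all)
  show ?case
    using progress next_state inevitable.step by metis
qed

lemma inevitable_call:
  assumes "cov f B A" and "\<And>g. post f g \<Longrightarrow> inevitable rstep F (0, Return g, st)"
  shows "inevitable rstep F (0, Call f, st)"
  using assms
proof (induction "deg f" arbitrary: f B A st rule: less_induct)
  case (less f B A st)
  note f = \<open>cov f B A\<close>
  show ?case
  proof (cases "deg f \<le> 2")
    case True
    have "post f f"
      using splitting_closure_small[OF f True] f cov_Cod[OF f] unfolding post_def by blast
    then have return: "inevitable rstep F (0, Return f, st)"
      by (rule less.prems(2))
    show ?thesis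
    proof (rule inevitable.step)
      show "rstep (0, Call f, st) (0, Return f, st)"
        using True by (rule R_step.small)
      fix z assume "rstep (0, Call f, st) z"
      then show "inevitable rstep F z"
        by cases (use return True in simp_all)
    qed
  next
    case False
    have components: "inevitable rstep F (Sig_time (Dom C p), Components f p, st)"
      if pq: "is_pullback C f f p q" for p q
    proof (rule inevitable_tick)
      have pb: "pullback f f (Dom C p) p q"
        using pq unfolding pullback_def by simp
      note ar = pullback_arrows[OF pb f f]
      have B: "B \<in> D"
        using cov_Dom_in[OF f] .
      show "Sig_time (Dom C p) < \<infinity>"
        using Sig_time Dom_Obj ar(1) by (auto simp: arrow_def)
      have collect: "inevitable rstep F (0, Collect f p (Sig (Dom C p)) {}, st)"
      proof (rule inevitable_collect[OF pb f less.prems(2)])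
        fix i st'
        assume i: "i \<in> Sig (Dom C p)"
          and cont: "\<And>g. post (p \<odot> i) g \<Longrightarrow> inevitable rstep F (0, Return g, st')"
        obtain W where W: "cov (p \<odot> i) W B"
          using cov_component[OF ar(1) B i] .
        have "deg (p \<odot> i) < deg f"
          using deg_component_less[OF pb f _ i] False by simp
        then show "inevitable rstep F (0, Call (p \<odot> i), st')"
          using less.hyps[OF _ W cont] by blast
      \<comment> \<open>Initially all components are pending and \<open>S\<close> is empty, so only
        \<open>I \<noteq> {}\<close> has content.\<close>
      qed (use Sig_nonempty[OF ar(1) B] in simp_all)
      show "inevitable rstep F (0, Components f p, st)"
      proof (rule inevitable.step)
        show "rstep (0, Components f p, st) (0, Collect f p (Sig (Dom C p)) {}, st)"
          by (rule R_step.components)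
        fix z assume "rstep (0, Components f p, st) z"
        then show "inevitable rstep F z"
          by cases (use collect in simp_all)
      qed
    qed
    obtain p q where pq: "is_pullback C f f p q"
      using pullback_ex[OF f f] unfolding pullback_def by blast
    have "inevitable rstep F (0, Pullback f, st)"
    proof (rule inevitable.step)
      show "rstep (0, Pullback f, st) (Sig_time (Dom C p), Components f p, st)"
        using pq by (rule R_step.pullback)
      fix z assume "rstep (0, Pullback f, st) z"
      then show "inevitable rstep F z"
        by cases (use components in simp_all)
    qed
    then have pullback: "inevitable rstep F (pb_time f f, Pullback f, st)"
      using pb_time[OF cov_cover[OF f] cov_cover[OF f] refl] by (rule inevitable_tick)
    show ?thesis
    proof (rule inevitable.step)
      show "rstep (0, Call f, st) (pb_time f f, Pullback f, st)"
        using False by (rule R_step.large)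
      fix z assume "rstep (0, Call f, st) z"
      then show "inevitable rstep F z"
        by cases (use pullback False in simp_all)
    qed
  qed
qed

section \<open>Termination and correctness of the outputs\<close>

definition final_state :: "'a \<Rightarrow> 'a state \<Rightarrow> bool" where
  "final_state f x \<longleftrightarrow> (\<exists>g. x = (0, Return g, []) \<and> post f g)"

lemma no_step_output: "\<not> rstep (0, Return g, []) z"
proof
  assume "rstep (0, Return g, []) z"
  then show False
    by cases simp_all
qed

lemma inevitable_final_state:
  assumes "cover C D f"
  shows "inevitable rstep (final_state f) (R_start deg_time f)"
  unfolding R_start_def
proof (rule inevitable_tick[OF _ deg_time[OF assms]])
  obtain B A where f: "cov f B A"
    using cover_obtains_cov[OF assms] .
  show "inevitable rstep (final_state f) (0, Call f, [])"
    by (rule inevitable_call[OF f]) (auto simp: final_state_def intro: inevitable.final)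
qed

lemma terminates:
  assumes "cover C D f"
  shows "R_terminates C Sig deg pb_time Sig_time deg_time f"
proof -
  have final: "\<forall>y z. final_state f y \<longrightarrow> \<not> rstep y z"
    using no_step_output unfolding final_state_def by blast
  note inev = inevitable_final_state[OF assms]
  have "\<exists>g. x = (0, Return g, [])" if "rstep\<^sup>*\<^sup>* (R_start deg_time f) x" "\<not> (\<exists>y. rstep x y)" for x
    using inevitable_stuck[OF that(1) inev final that(2)] unfolding final_state_def by blast
  then show ?thesis
    using inevitable_no_infinite_run[OF inev final] unfolding R_terminates_def Let_def by blast
qed

lemma output_galois_closure:
  assumes f: "cover C D f" and mono: "\<forall>U\<in>Obj C. \<forall>i\<in>Sig U. monic C i"
    and out: "R_outputs C Sig deg pb_time Sig_time deg_time f g"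
  shows "galois_closure C D deg f g"
proof -
  have final: "\<forall>y z. final_state f y \<longrightarrow> \<not> rstep y z"
    using no_step_output unfolding final_state_def by blast
  \<comment> \<open>An output state with empty stack has no successor, so it is a stuck reachable
    state and must satisfy the contract.\<close>
  have "final_state f (0, Return g, [])"
    using inevitable_stuck[OF out[unfolded R_outputs_def] inevitable_final_state[OF f] final]
      no_step_output by blast
  then have g: "post f g"
    unfolding final_state_def by simp
  obtain B A where BA: "cov f B A"
    using cover_obtains_cov[OF f] .
  obtain Y where "cov g Y A"
    using g cov_Cod[OF BA] unfolding post_def by blast
  then show ?thesis
    using galois_closure_if_splitting_closure[OF BA] g mono
    unfolding post_def monic_components_def by blast
qed

end

theorem theorem4p13:
  fixes C :: "('o, 'a) cat" and D :: "'o set"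
    and Sig :: "'o \<Rightarrow> 'a set" and deg :: "'a \<Rightarrow> nat"
    and pb_time :: "'a \<Rightarrow> 'a \<Rightarrow> enat" and Sig_time :: "'o \<Rightarrow> enat" and deg_time :: "'a \<Rightarrow> enat"
  assumes "galois_setting C D Sig deg"
    and "\<And>f g. \<lbrakk>cover C D f; cover C D g; Cod C f = Cod C g\<rbrakk> \<Longrightarrow> pb_time f g < \<infinity>"
    and "\<And>U. U \<in> Obj C \<Longrightarrow> Sig_time U < \<infinity>"
    and "\<And>f. cover C D f \<Longrightarrow> deg_time f < \<infinity>"
  shows "(\<forall>f. cover C D f \<longrightarrow> R_terminates C Sig deg pb_time Sig_time deg_time f) \<and>
    ((\<forall>U\<in>Obj C. \<forall>i\<in>Sig U. monic C i) \<longrightarrow>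
      (\<forall>f g. cover C D f \<and> R_outputs C Sig deg pb_time Sig_time deg_time f g \<longrightarrow>
        galois_closure C D deg f g))"
proof -
  interpret timed_galois_setting C D Sig deg pb_time Sig_time deg_time
    using assms by (simp add: timed_galois_setting_def timed_galois_setting_axioms_def)
  show ?thesis
    using terminates output_galois_closure by blast
qed

end
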